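(* Let $\mathcal X,\mathcal Y$ be real separable Hilbert spaces and $A:\mathrm{dom}(A)\subseteq\mathcal X\to\mathcal Y$ a (nonlinear) operator whose domain has nonempty interior. Let $X,\varepsilon$ be random variables with values in $\mathcal X$ and $\mathcal Y$ respectively, with $X\in\mathrm{int}(\mathrm{dom}(A))$ a.s., let $Y=A(X)+\varepsilon$ a.s., and let $X_0$ (the initialization) be a random variable with values in $\mathcal X$. Assume: (i) there is a constant $\tau>0$ such that $\mathbb E[\|\varepsilon\|_{\mathcal Y}^2|X]\le\tau^2$ a.s.; (ii) $A$ is continuous and weakly closed, $\mathrm{int}(\mathrm{dom}(A))$ is nonempty, $\mathrm{dom}(A)$ is convex, $A$ is Fréchet differentiable in $\mathrm{int}(\mathrm{dom}(A))$ with derivative $A'$, and there is a constant $C_0>0$ such that $\|A'(x)-A'(x')\|_{\mathrm{op}}\le C_0\|x-x'\|_{\mathcal X}$ for all $x,x'\in\mathrm{int}(\mathrm{dom}(A))$; (iii) $\|X-X_0\|_{\mathcal X}\le1$, and there are a random variable $Z$ with values in $\mathcal Y$ and $\beta>0$ such that almost surely $X-X_0=A'(X)^*Z$, and $\|Z\|_{\mathcal Y}\le\beta$ a.s., with $\beta C_0<1$; (iv) $\Lambda=\{\lambda_1,\dots,\lambda_N\}$ with $N\in\mathbb N$, $0<\lambda_1\le\dots\le\lambda_N<\infty$, $\lambda_j=\lambda_1Q^{j-1}$ for every $j=1,\dots,N$, where $Q=(\lambda_N/\lambda_1)^{1/(N-1)}$, and $\lambda_*=\tau/\beta\in[\lambda_1,\lambda_N]$.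 For every $\lambda\in(0,+\infty)$ let $f_\lambda(Y)=X_\lambda$, where $X_\lambda$ is a random variable satisfying, for almost all $\omega$, $$X_\lambda(\omega)\in\arg\min_{x\in\mathrm{dom}(A)}\|A(x)-Y(\omega)\|_{\mathcal Y}^2+\lambda\|x-X_0(\omega)\|_{\mathcal X}^2 .$$ Choose the loss $\ell(x,x')=\|T(x-X_0)-T(x'-X_0)\|_{\mathcal X}^2$. Let $(Y_i,X_i)$, $i=1,\dots,n$, be independent and identical copies of the pair $(Y,X)$, put $X^i_\lambda=f_\lambda(Y_i)$, and let $$\widehat\lambda_\Lambda\in\arg\min_{\lambda\in\Lambda}\frac1n\sum_{i=1}^n\|T(X_\lambda^i-X_0)-(X_i-X_0)\|_{\mathcal X}^2 .$$ Let $\eta\in(0,1)$. Then, with probability at least $1-\eta$, $$L(X_{\widehat\lambda_\Lambda})\le\frac{(1+Q)^2}{2Q(1-\beta C_0)}\tau\beta+\frac{26}{n}\log\frac{2N}{\eta}.$$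
   Context: The truncation operator $T:\mathcal X\to\mathcal X$ is $Tx=x$ if $\|x\|_{\mathcal X}\le1$ and $Tx=x/\|x\|_{\mathcal X}$ if $\|x\|_{\mathcal X}>1$. The expected risk of a measurable $f$ is $L(f)=\mathbb E[\|T(f(Y)-X_0)-T(X-X_0)\|_{\mathcal X}^2]$, and $L(X_\lambda)$ means $L(f_\lambda)$; $L(X_{\widehat\lambda_\Lambda})$ is the value of $\lambda\mapsto L(X_\lambda)$ at the data-dependent parameter $\lambda=\widehat\lambda_\Lambda$. The estimator $X_\lambda$ depends on both $Y$ and $X_0$; the dependence on $X_0$ is suppressed in the notation $f_\lambda(Y)$. The set of minimizers defining $X_\lambda$ is nonempty under (ii), and a measurable selection of minimizers is assumed to exist. "Weakly closed" means that if $x_k\in\mathrm{dom}(A)$, $x_k\rightharpoonup x$ weakly in $\mathcal X$ and $A(x_k)\rightharpoonup y$ weakly in $\mathcal Y$, then $x\in\mathrm{dom}(A)$ and $A(x)=y$.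
   Formalization: The sample consists of i.i.d. copies of the triple (Y, X, X_0), and the i-th term of the empirical risk uses its own copy of X_0; with one shared random X_0 in all terms the printed claim is false. For deterministic X_0 the two agree. *)

theory Defs
  imports "HOL-Probability.Probability"
begin

text \<open>
  A real separable Hilbert space is a type of sort
  \<open>{real_inner, banach, second_countable_topology}\<close>.
  A partial operator is a total function \<open>A\<close> together with its domain \<open>D\<close>; the values
  of \<open>A\<close> outside \<open>D\<close> are irrelevant.
\<close>

definition weakly_converges_to :: "(nat \<Rightarrow> 'a::real_normed_vector) \<Rightarrow> 'a \<Rightarrow> bool" where
  "weakly_converges_to u x \<longleftrightarrow>
     (\<forall>\<phi> :: 'a \<Rightarrow> real. bounded_linear \<phi> \<longrightarrow> (\<lambda>k. \<phi> (u k)) \<longlonglongrightarrow> \<phi> x)"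

definition weakly_closed_operator ::
  "'a::real_normed_vector set \<Rightarrow> ('a \<Rightarrow> 'b::real_normed_vector) \<Rightarrow> bool" where
  "weakly_closed_operator D A \<longleftrightarrow>
     (\<forall>u x y. (\<forall>k. u k \<in> D) \<and> weakly_converges_to u x \<and>
        weakly_converges_to (\<lambda>k. A (u k)) y \<longrightarrow> x \<in> D \<and> A x = y)"

definition tikhonov ::
  "('a::real_normed_vector \<Rightarrow> 'b::real_normed_vector) \<Rightarrow> real \<Rightarrow> 'b \<Rightarrow> 'a \<Rightarrow> 'a \<Rightarrow> real" where
  "tikhonov A \<alpha> y x0 x = (norm (A x - y))\<^sup>2 + \<alpha> * (norm (x - x0))\<^sup>2"

definition trunc :: "'a::real_normed_vector \<Rightarrow> 'a" where
  "trunc x = (if norm x \<le> 1 then x else x /\<^sub>R norm x)"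

definition trunc_loss :: "'a::real_normed_vector \<Rightarrow> 'a \<Rightarrow> 'a \<Rightarrow> real" where
  "trunc_loss x0 x x' = (norm (trunc (x - x0) - trunc (x' - x0)))\<^sup>2"

text \<open>
  Estimators depend on the datum and on the initialization, so they are functions of the pair
  \<open>(y, x0)\<close>.
\<close>

definition expected_risk ::
  "'w measure \<Rightarrow> ('w \<Rightarrow> 'b) \<Rightarrow> ('w \<Rightarrow> 'a::real_normed_vector) \<Rightarrow> ('w \<Rightarrow> 'a) \<Rightarrow>
     ('b \<times> 'a \<Rightarrow> 'a) \<Rightarrow> real" where
  "expected_risk M Y X X0 f =
     (\<integral>\<omega>. trunc_loss (X0 \<omega>) (f (Y \<omega>, X0 \<omega>)) (X \<omega>) \<partial>M)"

text \<open>
  The sample has indices \<open>1, \<dots>, n\<close>. The truncation acts on the estimator only.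
\<close>

definition empirical_risk ::
  "nat \<Rightarrow> (nat \<Rightarrow> 'w \<Rightarrow> 'b) \<Rightarrow> (nat \<Rightarrow> 'w \<Rightarrow> 'a::real_normed_vector) \<Rightarrow> (nat \<Rightarrow> 'w \<Rightarrow> 'a) \<Rightarrow>
     ('b \<times> 'a \<Rightarrow> 'a) \<Rightarrow> 'w \<Rightarrow> real" where
  "empirical_risk n Ys Xs X0s f \<omega> =
     (1 / real n) * (\<Sum>i = 1..n.
        (norm (trunc (f (Ys i \<omega>, X0s i \<omega>) - X0s i \<omega>) - (Xs i \<omega> - X0s i \<omega>)))\<^sup>2)"

end

theory Submission
  imports Defs
begin

text \<open>
  Write \<open>u = f \<lambda> (Y, X0) - X\<close>. Comparing the Tikhonov functional at its minimizer only with its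
  value at \<open>X\<close> gives \<open>\<lambda> (1 - \<beta> C0) \<parallel>u\<parallel>\<^sup>2 \<le> (\<parallel>\<epsilon>\<parallel> + \<lambda> \<beta>)\<^sup>2\<close>, which is too weak by a factor of two.
  Comparing it with the values on the whole segment from \<open>X\<close> to the minimizer (at \<open>X\<close>, at an
  intermediate point, and infinitesimally at the minimizer) removes the cross term and gives
  \<open>\<lambda> (1 - \<beta> C0) \<parallel>u\<parallel>\<^sup>2 \<le> \<parallel>\<epsilon>\<parallel>\<^sup>2 + 2/3 (\<lambda> \<beta>)\<^sup>2\<close>. A grid point near \<open>\<tau> / \<beta>\<close> therefore has risk at most
  \<open>R = 11/13 K\<close>, where \<open>K\<close> is the first term of the claimed bound.

  A grid point of risk \<open>r > R\<close> beats this one on the sample with probability at most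
  \<open>exp (- n (sqrt r - sqrt R)\<^sup>2 / 4)\<close>. By a union bound the selected parameter has, with probability
  at least \<open>1 - \<eta>\<close>, a risk of at most \<open>(sqrt R + 2 sqrt s)\<^sup>2 \<le> 13/11 R + 26 s\<close>
  with \<open>s = ln (N / \<eta>) / n\<close>.
\<close>

section \<open>Numerical inequalities\<close>

lemma quad_nonneg:
  fixes a b c G :: real
  assumes "a > 0" "b\<^sup>2 < a * c"
  shows "0 < a * G\<^sup>2 + 2 * b * G + c"
proof -
  have "0 < (a * G + b)\<^sup>2 + (a * c - b\<^sup>2)"
    using assms(2) by (intro add_nonneg_pos) auto
  also have "\<dots> = a * (a * G\<^sup>2 + 2 * b * G + c)"
    by (simp add: power2_eq_square algebra_simps)
  finally show ?thesis using assms(1) by (simp add: zero_less_mult_iff)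
qed

text \<open>
  The difference is a quadratic in \<open>G\<close>: its discriminant is negative for \<open>x \<le> 5\<close>, and its
  coefficients are nonnegative for \<open>x \<ge> 5\<close>.
\<close>

lemma key_polynomial:
  fixes x G k s :: real
  assumes x: "x \<ge> 0" and G: "G \<ge> 0" and k: "k \<ge> 5/6 + x + x\<^sup>2/2"
    and s: "s = 48 * x\<^sup>2 + 5"
  shows "(s + 3) * (G\<^sup>2/2 + (6*x+2) * G - 3*x\<^sup>2 - 6*x - 37/12) < s * (G + k)\<^sup>2"
proof -
  \<comment> \<open>\<open>a\<close>, \<open>2 * b\<close> and \<open>c\<close> are the coefficients
    in G of twice the difference of the two sides at the smallest admissible k, which is
    \<open>k0\<close>.\<close>
  define k0 where "k0 = 5/6 + x + x\<^sup>2/2"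
  define a where "a = s - 3"
  define b where "b = s * (x\<^sup>2 - 4*x - 1/3) - 18*x - 6"
  define c where "c = 2 * s * k0\<^sup>2 + 2*(s+3)*(3*x\<^sup>2+6*x+37/12)"
  have apos: "a > 0" unfolding a_def s by (simp add: add_pos_nonneg)
  have spos: "s > 0" using apos unfolding a_def by simp
  have cpos: "c > 0" unfolding c_def using spos x by (intro add_nonneg_pos mult_pos_pos) (auto intro!: add_nonneg_pos)
  have main: "0 < a * G\<^sup>2 + 2 * b * G + c"
  proof (cases "x \<le> 5")
    case True
    have "a * c - b\<^sup>2 = -1152*x^8 + 23040*x^7 - 13368*x^6 + 35424*x^5 + 7548*x^4 + 3120*x^3
        + 5840/3*x^2 - 1072/3*x + 484/9"
      unfolding a_def b_def c_def k0_def s by (simp add: power2_eq_square field_simps power_numeral_reduce)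
    \<comment> \<open>For 0 \<le> x \<le> 5 every group is nonnegative: part of the degree seven
      term absorbs the degree eight one, and both quadratics have negative discriminant.\<close>
    also have "\<dots> = x^7 * (1152 * (5 - x)) + x^5 * (17280*x\<^sup>2 - 13368*x + 35424)
        + 7548*x^4 + 3120*x^3 + (5840/3*x^2 - 1072/3*x + 484/9)"
      by (simp add: power2_eq_square field_simps power_numeral_reduce)
    also have "\<dots> > 0"
    proof -
      have 1: "17280*x\<^sup>2 - 13368*x + 35424 > 0" 
        using quad_nonneg[of 17280 "-6684" 35424 x] by (simp add: power2_eq_square)
      have 2: "5840/3*x^2 - 1072/3*x + 484/9 > 0" 
        using quad_nonneg[of "5840/3" "-536/3" "484/9" x] by (simp add: power2_eq_square)
      show ?thesis using x True less_imp_le[OF 1] 2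
        by (intro add_nonneg_pos[OF add_nonneg_nonneg[OF add_nonneg_nonneg[OF add_nonneg_nonneg]]] mult_nonneg_nonneg) (assumption | simp)+
    qed
    finally show ?thesis using apos by (intro quad_nonneg) auto
  next
    case False
    have "x\<^sup>2 - 4*x - 1/3 \<ge> 4" using False mult_mono[of 5 x 1 "x-4"] by (simp add: power2_eq_square algebra_simps)
    hence "s * (x\<^sup>2 - 4*x - 1/3) \<ge> s * 4" using spos by (intro mult_left_mono) auto
    moreover have "x\<^sup>2 \<ge> 5 * x" using False unfolding power2_eq_square by (intro mult_right_mono) auto
    ultimately have "b \<ge> 0" unfolding b_def using False s by linarith
    thus ?thesis using apos cpos G by (intro add_nonneg_pos) auto
  qed
  have "a * G\<^sup>2 + 2 * b * G + c = 2 * (s * (G + k0)\<^sup>2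
      - (s + 3) * (G\<^sup>2/2 + (6*x+2) * G - 3*x\<^sup>2 - 6*x - 37/12))"
    unfolding a_def b_def c_def k0_def s by (simp add: power2_eq_square field_simps)
  with main have "(s + 3) * (G\<^sup>2/2 + (6*x+2) * G - 3*x\<^sup>2 - 6*x - 37/12) < s * (G + k0)\<^sup>2"
    by simp
  also have "\<dots> \<le> s * (G + k)\<^sup>2"
    using spos k G x unfolding k0_def by (intro mult_left_mono power_mono) auto
  finally show ?thesis .
qed

section \<open>Cost of replacing the ideal parameter by a point of the geometric grid\<close>

lemma half_square_ratio_mono:
  fixes a Q :: real
  assumes "1 \<le> a" "a \<le> Q"
  shows "(1+a)\<^sup>2/(2*a) \<le> (1+Q)\<^sup>2/(2*Q)"
proof -
  \<comment> \<open>In this form only the monotonicity of u + 1/u for u \<ge> 1 is left.\<close>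
  have eq: "(1+u)\<^sup>2/(2*u) = 1 + (u + 1/u)/2" if "1 \<le> u" for u :: real
    using that by (simp add: field_simps power2_eq_square)
  have "1 \<le> a * Q" using assms mult_mono[of 1 a 1 Q] by simp
  hence "(Q - a) / (a * Q) \<le> Q - a" using assms divide_left_mono[of 1 "a * Q" "Q - a"] by simp
  moreover have "(Q - a) / (a * Q) = 1/a - 1/Q" using assms by (simp add: field_simps)
  ultimately have "a + 1/a \<le> Q + 1/Q" by linarith
  thus ?thesis using assms eq[of a] eq[of Q] by simp
qed

text \<open>The right side increases with Q, so the worst case is Q = q^2. There, after clearing
  denominators, the difference is a quartic with positive coefficients in powers of q - 1.\<close>

lemma grid_constant_small:
  fixes q Q :: real
  assumes "1 \<le> q" "q\<^sup>2 \<le> Q"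
  shows "13/11 * (1/q + 2*q/3) \<le> (1+Q)\<^sup>2/(2*Q)"
proof -
  have q0: "q > 0" and q1: "q\<^sup>2 \<ge> 1" using assms by (auto simp: one_le_power)
  have "0 \<le> 33*q^4 - 52*q^3 + 66*q\<^sup>2 - 78*q + 33"
  proof -
    define y where "y = q - 1"
    have "33*q^4 - 52*q^3 + 66*q\<^sup>2 - 78*q + 33 = 33*y^4 + 80*y^3 + 108*y\<^sup>2 + 30*y + 2"
      unfolding y_def by (simp add: power2_eq_square algebra_simps power_numeral_reduce)
    also have "\<dots> \<ge> 0"
    proof -
      have "y \<ge> 0" using assms unfolding y_def by simp
      thus ?thesis by simp
    qed
    finally show ?thesis .
  qed
  hence "0 \<le> (33*q^4 - 52*q^3 + 66*q\<^sup>2 - 78*q + 33) / (66 * q\<^sup>2)" by simp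
  also have "\<dots> = (1+q\<^sup>2)\<^sup>2/(2*q\<^sup>2) - 13/11 * (1/q + 2*q/3)"
    using q0 by (simp add: field_simps power2_eq_square power_numeral_reduce)
  finally have "13/11 * (1/q + 2*q/3) \<le> (1+q\<^sup>2)\<^sup>2/(2*q\<^sup>2)" by simp
  also have "\<dots> \<le> (1+Q)\<^sup>2/(2*Q)"
    using q1 assms by (intro half_square_ratio_mono)
  finally show ?thesis .
qed

text \<open>At Q = r^2 the inequality fails for r near 1.2, which is why Q is kept away from 1. For
  r \<le> 3/2 the value of the right side at Q = 5/2 is enough; for larger r the reduction to Q =
  r^2 works, with a quartic having positive coefficients in powers of r - 3/2.\<close>

lemma grid_constant_large:
  fixes r Q :: real
  assumes "1 \<le> r" "r\<^sup>2 \<le> Q" "5/2 \<le> Q"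
  shows "13/11 * (r + 2/(3*r)) \<le> (1+Q)\<^sup>2/(2*Q)"
proof (cases "r \<le> 3/2")
  case True
  have "0 \<le> (r - 1) * (3/2 - r)" using True assms by (intro mult_nonneg_nonneg) auto
  moreover have "(r - 1) * (3/2 - r) = 5/2 * r - 3/2 - r * r" by (simp add: field_simps)
  ultimately have "780 * (r * r) \<le> 1950 * r - 1170" by linarith
  hence "13/11 * (r + 2/(3*r)) \<le> 49/20"
    using assms True by (simp add: divide_simps) (simp add: power2_eq_square algebra_simps)?
  also have "\<dots> \<le> (1+Q)\<^sup>2/(2*Q)"
    using half_square_ratio_mono[of "5/2" Q] assms by (simp add: power2_eq_square)
  finally show ?thesis .
next
  case False
  hence r0: "r > 0" and r1: "r\<^sup>2 \<ge> 1" using assms(1) by auto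
  have "0 \<le> 33*r^4 - 78*r^3 + 66*r\<^sup>2 - 52*r + 33"
  proof -
    define y where "y = r - 3/2"
    have "33*r^4 - 78*r^3 + 66*r\<^sup>2 - 52*r + 33 = 33*y^4 + 120*y^3 + 321/2*y\<^sup>2 + 65*y + 117/16"
      unfolding y_def by (simp add: power2_eq_square field_simps power_numeral_reduce)
    also have "\<dots> \<ge> 0"
    proof -
      have "y \<ge> 0" using False unfolding y_def by simp
      thus ?thesis by simp
    qed
    finally show ?thesis .
  qed
  hence "0 \<le> (33*r^4 - 78*r^3 + 66*r\<^sup>2 - 52*r + 33) / (66 * r\<^sup>2)" by simp
  also have "\<dots> = (1+r\<^sup>2)\<^sup>2/(2*r\<^sup>2) - 13/11 * (r + 2/(3*r))"
    using r0 by (simp add: field_simps power2_eq_square power_numeral_reduce)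
  finally have "13/11 * (r + 2/(3*r)) \<le> (1+r\<^sup>2)\<^sup>2/(2*r\<^sup>2)" by simp
  also have "\<dots> \<le> (1+Q)\<^sup>2/(2*Q)"
    using r1 assms by (intro half_square_ratio_mono)
  finally show ?thesis .
qed

text \<open>\<open>q\<close> and \<open>q / Q\<close> are the ratios to \<open>\<tau> / \<beta>\<close> of the two grid points around it.\<close>

lemma grid_constant:
  fixes q Q :: real
  assumes "1 \<le> q" "q \<le> Q"
  shows "13/11 * (1/q + 2*q/3) \<le> (1+Q)\<^sup>2/(2*Q) \<or> 13/11 * (Q/q + 2*(q/Q)/3) \<le> (1+Q)\<^sup>2/(2*Q)"
proof (cases "q\<^sup>2 \<le> Q")
  case True
  thus ?thesis using grid_constant_small assms by blast
next
  case False
  \<comment> \<open>Past the geometric middle, q^2 > Q, the upper grid point still works if Q \<le>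
    5/2; for larger Q the lower one is taken.\<close>
  show ?thesis
  proof (cases "Q \<le> 5/2")
    case True
    \<comment> \<open>1/q lies below the chord of this convex function over [1, Q].\<close>
    have "0 \<le> (q - 1) * (Q - q)" using assms by (intro mult_nonneg_nonneg) auto
    moreover have "1 + 1/Q - q/Q - 1/q = (q - 1) * (Q - q) / (q * Q)"
      using assms by (simp add: field_simps)
    ultimately have "1/q \<le> 1 + 1/Q - q/Q" using assms
      by (smt (verit) divide_nonneg_nonneg mult_nonneg_nonneg)
    hence 1: "1/q + 2*q/3 \<le> 1 + 1/Q - q/Q + 2*q/3" by simp
    have 2: "13/11 * (1 + 1/Q - q/Q + 2*q/3) \<le> (1+Q)\<^sup>2/(2*Q)"
    proof -
      have "0 \<le> (Q - 1) * (5/2 - Q)" using assms True by (intro mult_nonneg_nonneg) auto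
      moreover have "(Q - 1) * (5/2 - Q) = 7/2 * Q - 5/2 - Q * Q" by (simp add: field_simps)
      ultimately have "Q * Q \<le> 7/2 * Q - 5/2" by linarith
      hence a: "19 * Q\<^sup>2 - 66 * Q + 45 \<le> 0" using assms True unfolding power2_eq_square by linarith
      have b: "66 * Q * (13/11 * (1 + 1/Q - q/Q + 2*q/3)) = 78 * Q + 78 + 78 * q * (2*Q/3 - 1)" 
        using assms by (simp add: field_simps)
      have c: "66 * Q * ((1+Q)\<^sup>2/(2*Q)) = 33 * (1+Q)\<^sup>2" using assms by (simp add: field_simps)
      \<comment> \<open>The bound is now affine in q, so the endpoints 1 and Q suffice; the endpoint
        Q is the one that uses Q \<le> 5/2.\<close>
      have "78 * q * (2*Q/3 - 1) \<le> max (78 * (2*Q/3 - 1)) (78 * Q * (2*Q/3 - 1))"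
      proof (cases "2*Q/3 - 1 \<ge> 0")
        case True
        thus ?thesis using assms by (intro max.coboundedI2 mult_right_mono) auto
      next
        case False
        thus ?thesis using assms by (intro max.coboundedI1 mult_right_mono_neg) auto
      qed
      moreover have "78 * Q + 78 + 78 * (2*Q/3 - 1) \<le> 33 * (1+Q)\<^sup>2"
      proof -
        have "0 \<le> 33 * (Q - 1)\<^sup>2 + 2 * Q" using assms by simp
        thus ?thesis by (simp add: power2_eq_square algebra_simps)
      qed
      moreover have "78 * Q + 78 + 78 * Q * (2*Q/3 - 1) \<le> 33 * (1+Q)\<^sup>2"
        using a by (simp add: power2_eq_square algebra_simps)
      ultimately have "66 * Q * (13/11 * (1 + 1/Q - q/Q + 2*q/3)) \<le> 66 * Q * ((1+Q)\<^sup>2/(2*Q))"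
        unfolding b c by linarith
      thus ?thesis using assms by (subst (asm) mult_le_cancel_left_pos) auto
    qed
    from 1 2 show ?thesis by argo
  next
    case False': False
    define r where "r = Q / q"
    have "r \<ge> 1" using assms by (simp add: r_def)
    moreover have "r\<^sup>2 \<le> Q"
      using False assms by (simp add: r_def power_divide divide_simps power2_eq_square)
    ultimately have "13/11 * (r + 2/(3*r)) \<le> (1+Q)\<^sup>2/(2*Q)"
      using False' by (intro grid_constant_large) auto
    thus ?thesis unfolding r_def by simp
  qed
qed

section \<open>The error of a Tikhonov minimizer\<close>

text \<open>
  All quantities are scaled so that \<open>\<lambda> = \<beta> = 1\<close>: \<open>b\<close> is the image of \<open>u\<close> under the derivative at
  \<open>X\<close>, \<open>d\<close> the increment of the operator along \<open>u\<close>, \<open>e\<close> the noise, \<open>S\<close> the squared error, and \<open>g = \<beta> C0 S\<close>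
  bounds the curvature. The assumptions \<open>h0\<close>, \<open>h1\<close> and \<open>h2\<close> compare the minimizer with \<open>X\<close>, with
  points close to the minimizer, and with the points at parameter \<open>t\<close>.
  If the claim failed, \<open>h0\<close> and \<open>h1\<close> would force \<open>g\<close>, hence \<open>norm b\<close>, to be so large that the functional
  drops below its minimum near \<open>X\<close>, which contradicts \<open>h2\<close>.
\<close>

lemma tikhonov_core:
  fixes b d e :: "'b::real_inner" and S g :: real
  assumes g: "0 \<le> g"
    and h0: "S \<le> 2 * norm b + (norm e)\<^sup>2 - (norm (d - e))\<^sup>2"
    and h1: "S \<le> norm b + inner d (e - d) + g * norm (d - e) / 2"
    and h2: "\<And>t. 0 \<le> t \<Longrightarrow> t \<le> 1 \<Longrightarrow>
      S * (1 - t\<^sup>2) \<le> 2 * norm b * (1 - t) + (norm (t *\<^sub>R b - e) + g * t\<^sup>2 / 2)\<^sup>2 - (norm (d - e))\<^sup>2"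
    and h3: "norm (d - b) \<le> g / 2"
  shows "S - g \<le> (norm e)\<^sup>2 + 2/3"
proof (rule ccontr)
  \<comment> \<open>Since d differs from b by at most G, its component along the direction v of b is
    at least k; x measures how far the residual norm D exceeds 1.\<close>
  define p k G \<rho> D x where "p = norm b" and "k = norm b - g/2" and "G = g/2"
    and "\<rho> = norm e" and "D = norm (d - e)" and "x = norm (d - e) - 1"
  define v where "v = b /\<^sub>R p"
  define \<epsilon> where "\<epsilon> = inner e v"
  have gG: "g = 2 * G" and pk: "p = G + k" and D: "D = 1 + x" by (simp_all add: p_def k_def G_def D_def x_def)
  have G0: "G \<ge> 0" using g by (simp add: G_def)
  have \<rho>0: "\<rho> \<ge> 0" and D0: "D \<ge> 0" by (simp_all add: \<rho>_def D_def)
  assume "\<not> S - g \<le> (norm e)\<^sup>2 + 2/3"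
  hence V: "S > \<rho>\<^sup>2 + 2/3 + 2 * G" by (simp add: \<rho>_def gG)
  have k_gt: "k > 1/3 + D\<^sup>2 / 2"
    using h0 V unfolding \<rho>_def[symmetric] D_def[symmetric] p_def[symmetric] pk by (simp add: field_simps)
  hence k0: "k > 0" using zero_le_power2[of D] by argo
  hence p0: "p > 0" using G0 by (simp add: pk)
  have nv: "norm v = 1" using p0 by (simp add: v_def p_def)
  have bv: "b = p *\<^sub>R v" using p0 by (simp add: v_def)
  have vv: "inner v v = 1" using nv by (simp add: dot_square_norm)
  have kd: "k \<le> inner d v"
  proof -
    have "inner (b - d) v \<le> norm (b - d) * norm v" by (rule norm_cauchy_schwarz)
    also have "\<dots> \<le> G" using h3 nv by (simp add: norm_minus_commute G_def)
    finally have "p - inner d v \<le> G" using vv by (simp add: inner_diff_left bv)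
    thus ?thesis by (simp add: pk)
  qed
  have kD: "k \<le> \<epsilon> + D"
  proof -
    have "inner (d - e) v \<le> D * 1" unfolding D_def nv[symmetric] by (rule norm_cauchy_schwarz)
    thus ?thesis using kd by (simp add: \<epsilon>_def inner_diff_left)
  qed
  have kn: "k \<le> norm d" using kd norm_cauchy_schwarz[of d v] nv by simp
  have \<epsilon>\<rho>: "\<bar>\<epsilon>\<bar> \<le> \<rho>" using Cauchy_Schwarz_ineq2[of e v] nv by (simp add: \<epsilon>_def \<rho>_def)
  hence \<epsilon>2: "\<epsilon>\<^sup>2 \<le> \<rho>\<^sup>2" using \<rho>0 by (metis abs_le_square_iff abs_of_nonneg)
  have dsq: "inner d (e - d) = (\<rho>\<^sup>2 - D\<^sup>2 - (norm d)\<^sup>2) / 2"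
    by (simp add: \<rho>_def D_def power2_norm_eq_inner inner_diff_left inner_diff_right inner_commute)
  \<comment> \<open>In \<open>h1\<close> the norm of d is at least k, and k - k^2/2 is at most 1/2;
    what remains of the negated claim forces G * x to be large.\<close>
  have Gx: "\<rho>\<^sup>2 + x\<^sup>2 + 2 * x + 4/3 \<le> 2 * G * x"
  proof -
    have "S \<le> G + k + (\<rho>\<^sup>2 - D\<^sup>2 - (norm d)\<^sup>2) / 2 + G * (1 + x)"
      using h1 unfolding dsq D_def[symmetric] p_def[symmetric] gG pk D by simp
    moreover have "k\<^sup>2 \<le> (norm d)\<^sup>2" using k0 kn by (intro power_mono) auto
    moreover have "2 * k - 1 \<le> k\<^sup>2" using zero_le_power2[of "k - 1"] by (simp add: power2_diff)
    moreover have "G * (1 + x) = G + G * x" by (simp add: algebra_simps)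
    moreover have "D\<^sup>2 = 1 + 2 * x + x\<^sup>2" by (simp add: D power2_eq_square algebra_simps)
    ultimately show ?thesis using V by argo
  qed
  have x0: "x > 0"
  proof (rule ccontr)
    assume "\<not> x > 0"
    hence "G * x \<le> 0" using G0 by (simp add: mult_nonneg_nonpos)
    moreover have "0 \<le> (x + 1)\<^sup>2" by simp
    moreover have "(x + 1)\<^sup>2 = x\<^sup>2 + 2 * x + 1" by (simp add: power2_sum)
    moreover have "0 \<le> \<rho>\<^sup>2" by simp
    ultimately show False using Gx by argo
  qed
  have D2: "D\<^sup>2 = 1 + 2 * x + x\<^sup>2" by (simp add: D power2_eq_square algebra_simps)
  have kx: "5/6 + x + x\<^sup>2 / 2 \<le> k" using k_gt unfolding D2 by (simp add: field_simps)
  have x\<epsilon>: "x\<^sup>2 < 2 * \<epsilon> + 1/3" using k_gt kD D D2 by argo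
  hence \<epsilon>low: "\<epsilon> > -1/6" using zero_le_power2[of x] by argo
  \<comment> \<open>By \<open>Gx\<close> and the arithmetic-geometric mean inequality the curvature
    dominates the noise. Hence the trial length T below stays within the segment (T \<le>
    p).\<close>
  have G\<rho>: "\<rho> + 1 \<le> G"
  proof -
    have "0 \<le> (\<rho> - x)\<^sup>2" by simp
    hence "2 * \<rho> * x \<le> \<rho>\<^sup>2 + x\<^sup>2" by (simp add: power2_diff)
    hence "(\<rho> + 1) * (2 * x) \<le> G * (2 * x)" using Gx by (simp add: algebra_simps)
    thus ?thesis using x0 by simp
  qed
  \<comment> \<open>The distance \<open>T\<close> along \<open>v\<close> almost minimizes the quadratic part \<open>T\<^sup>2 - 2 T (1 + \<epsilon>)\<close> of the drop; the
    offset \<open>1/4\<close> instead of \<open>1\<close> leaves room for the curvature terms.\<close>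
  define T t m where "T = \<epsilon> + 1/4" and "t = T / p" and "m = sqrt (1/16 + \<rho>\<^sup>2 - \<epsilon>\<^sup>2)"
  have T0: "0 < T" using \<epsilon>low by (simp add: T_def)
  have Tp: "T \<le> p" using G\<rho> \<epsilon>\<rho> k0 by (simp add: T_def pk)
  have t0: "0 \<le> t" and t1: "t \<le> 1" using T0 Tp p0 by (simp_all add: t_def)
  have tp: "t * p = T" using p0 by (simp add: t_def)
  have m0: "m \<ge> 0" and m2: "m\<^sup>2 = 1/16 + \<rho>\<^sup>2 - \<epsilon>\<^sup>2" using \<epsilon>2 by (simp_all add: m_def)
  have tb: "norm (t *\<^sub>R b - e) = m"
  proof -
    have "(norm (t *\<^sub>R b - e))\<^sup>2 = (norm (T *\<^sub>R v - e))\<^sup>2" unfolding bv by (simp add: tp)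
    also have "\<dots> = T\<^sup>2 - 2 * T * \<epsilon> + \<rho>\<^sup>2"
      unfolding \<rho>_def \<epsilon>_def using vv
      by (simp only: power2_norm_eq_inner) (simp add: inner_diff_left inner_diff_right inner_commute power2_eq_square algebra_simps)
    also have "\<dots> = m\<^sup>2" unfolding m2 T_def by (simp add: power2_eq_square field_simps)
    finally show ?thesis using m0 by (simp add: power2_eq_iff_nonneg)
  qed
  have t2: "t\<^sup>2 \<le> 1" using t0 t1 by (simp add: power_le_one)
  have "(\<rho>\<^sup>2 + 2/3 + 2 * G) * (1 - t\<^sup>2) \<le> S * (1 - t\<^sup>2)"
    using V t2 by (intro mult_right_mono) auto
  also have "\<dots> \<le> 2 * p * (1 - t) + (m + G * t\<^sup>2)\<^sup>2 - D\<^sup>2"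
    using h2[OF t0 t1] unfolding tb p_def[symmetric] D_def[symmetric] gG by simp
  also have "\<dots> = 2 * G + 2 * k - 2 * T + m\<^sup>2 + t\<^sup>2 * (2 * G * m + G\<^sup>2 * t\<^sup>2) - D\<^sup>2"
    unfolding tp[symmetric] pk by (simp add: power2_eq_square algebra_simps)
  finally have dip: "(\<rho>\<^sup>2 + 2/3 + 2 * G) * (1 - t\<^sup>2)
      \<le> 2 * G + 2 * k - 2 * T + m\<^sup>2 + t\<^sup>2 * (2 * G * m + G\<^sup>2 * t\<^sup>2) - D\<^sup>2" .
  \<comment> \<open>Inserting \<open>kD\<close> cancels the first-order terms in \<epsilon> and x.
    The left side stays at least 5/48, while every term on the right carries a factor t^2.\<close>
  have "5/48 + x\<^sup>2 + \<epsilon>\<^sup>2 \<le> t\<^sup>2 * (\<rho>\<^sup>2 + 2/3 + 2 * G) + t\<^sup>2 * (2 * G * m + G\<^sup>2 * t\<^sup>2)"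
  proof -
    have "(\<rho>\<^sup>2 + 2/3 + 2 * G) * (1 - t\<^sup>2) = \<rho>\<^sup>2 + 2/3 + 2 * G - t\<^sup>2 * (\<rho>\<^sup>2 + 2/3 + 2 * G)"
      by (simp add: field_simps)
    thus ?thesis using dip kD D2 m2 T_def D by argo
  qed
  also have "\<dots> = t\<^sup>2 * (\<rho>\<^sup>2 + 2/3 + 2 * G * (1 + m) + G\<^sup>2 * t\<^sup>2)"
    by (simp add: algebra_simps)
  also have "\<dots> \<le> t\<^sup>2 * (\<rho>\<^sup>2 + 2/3 + 2 * G * (1 + m) + T\<^sup>2)"
  proof -
    have "G * t \<le> T" unfolding tp[symmetric] using k0 t0 by (simp add: pk algebra_simps)
    hence "(G * t)\<^sup>2 \<le> T\<^sup>2" using G0 t0 by (intro power_mono) auto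
    thus ?thesis by (intro mult_left_mono) (auto simp: power_mult_distrib)
  qed
  finally have "p\<^sup>2 * (5/48 + x\<^sup>2 + \<epsilon>\<^sup>2) \<le> p\<^sup>2 * (t\<^sup>2 * (\<rho>\<^sup>2 + 2/3 + 2 * G * (1 + m) + T\<^sup>2))"
    by (rule mult_left_mono) simp
  hence "(5/48 + x\<^sup>2 + \<epsilon>\<^sup>2) * p\<^sup>2 \<le> (t * p)\<^sup>2 * (\<rho>\<^sup>2 + 2/3 + 2 * G * (1 + m) + T\<^sup>2)"
    by (simp only: power_mult_distrib mult_ac)
  hence pineq: "(5/48 + x\<^sup>2 + \<epsilon>\<^sup>2) * p\<^sup>2 \<le> T\<^sup>2 * (\<rho>\<^sup>2 + 2/3 + 2 * G * (1 + m) + T\<^sup>2)"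
    by (simp only: tp)
  \<comment> \<open>Young's inequality on G * m costs 2 m^2, so \<rho>^2 appears three times in all;
    three copies of \<open>Gx\<close> trade it for G and x. The square of \<epsilon> - 1/4 removes
    \<epsilon>.\<close>
  have Nb: "\<rho>\<^sup>2 + 2/3 + 2 * G * (1 + m) + T\<^sup>2 \<le> G\<^sup>2/2 + (6*x+2) * G - 3*x\<^sup>2 - 6*x - 37/12" (is "?N \<le> ?B")
  proof -
    have "0 \<le> (G - 2 * m)\<^sup>2" by simp
    hence "2 * G * m \<le> 2 * m\<^sup>2 + G\<^sup>2 / 2" by (simp add: power2_diff power_mult_distrib)
    moreover have "T\<^sup>2 = \<epsilon>\<^sup>2 + \<epsilon>/2 + 1/16" by (simp add: T_def power2_eq_square field_simps)
    moreover have "0 \<le> (\<epsilon> - 1/4)\<^sup>2" by simp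
    moreover have "(\<epsilon> - 1/4)\<^sup>2 = \<epsilon>\<^sup>2 - \<epsilon>/2 + 1/16" by (simp add: power2_eq_square field_simps)
    moreover have "2 * G * (1 + m) = 2 * G + 2 * G * m" by (simp add: algebra_simps)
    moreover have "(6*x+2) * G = 3 * (2 * G * x) + 2 * G" by (simp add: algebra_simps)
    ultimately show ?thesis using Gx m2 by argo
  qed
  \<comment> \<open>With r/48 = 5/48 + x^2, Cauchy-Schwarz gives T^2 \<le> (1 + 3/r) (r/48 +
    \<epsilon>^2). The factor containing \<epsilon> then cancels and \<open>key_polynomial\<close>
    applies.\<close>
  define r where "r = 48 * x\<^sup>2 + 5"
  have r0: "r > 0" by (simp add: r_def add_nonneg_pos)
  have "?N \<ge> 0" using G0 m0 by simp
  have CS: "r * T\<^sup>2 \<le> (r + 3) * (5/48 + x\<^sup>2 + \<epsilon>\<^sup>2)"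
  proof -
    have a: "5/48 + x\<^sup>2 = r / 48" by (simp add: r_def field_simps)
    have "0 \<le> (12 * \<epsilon> - r)\<^sup>2 / 48" by simp
    also have "\<dots> = (r + 3) * (r / 48 + \<epsilon>\<^sup>2) - r * T\<^sup>2"
      by (simp add: T_def power2_eq_square field_simps)
    finally show ?thesis by (simp add: a)
  qed
  have pos: "5/48 + x\<^sup>2 + \<epsilon>\<^sup>2 > 0" by (simp add: add_pos_nonneg)
  have "(5/48 + x\<^sup>2 + \<epsilon>\<^sup>2) * (r * p\<^sup>2) \<le> r * T\<^sup>2 * ?N"
    using mult_left_mono[OF pineq, of r] r0 by (simp add: mult_ac)
  also have "\<dots> \<le> (r + 3) * (5/48 + x\<^sup>2 + \<epsilon>\<^sup>2) * ?N"
    using CS \<open>?N \<ge> 0\<close> by (rule mult_right_mono)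
  finally have "(5/48 + x\<^sup>2 + \<epsilon>\<^sup>2) * (r * p\<^sup>2) \<le> (5/48 + x\<^sup>2 + \<epsilon>\<^sup>2) * ((r + 3) * ?N)"
    by (simp add: mult_ac)
  hence "r * p\<^sup>2 \<le> (r + 3) * ?N" using pos by (simp only: mult_le_cancel_left_pos)
  also have "\<dots> \<le> (r + 3) * ?B" using Nb r0 by (intro mult_left_mono) auto
  also have "\<dots> < r * (G + k)\<^sup>2" by (rule key_polynomial) (use x0 G0 kx r_def in auto)
  finally show False by (simp add: pk)
qed

text \<open>The representer is the minimizer of norm(u)^2 - 2 \<phi>(u). The parallelogram identity
  makes a minimizing sequence Cauchy, and the first variation vanishes at its limit.\<close>

lemma riesz_representation:
  fixes \<phi> :: "'a::{real_inner, banach} \<Rightarrow> real"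
  assumes "bounded_linear \<phi>"
  obtains r where "\<And>y. \<phi> y = inner r y"
proof -
  interpret bounded_linear \<phi> by fact
  define J where "J u = (norm u)\<^sup>2 - 2 * \<phi> u" for u
  obtain K where K: "\<And>u. norm (\<phi> u) \<le> norm u * K" using bounded by blast
  have low: "J u \<ge> - K\<^sup>2" for u
  proof -
    have "0 \<le> (norm u - K)\<^sup>2" by simp
    moreover have "\<phi> u \<le> norm u * K" using K[of u] by simp
    ultimately show ?thesis unfolding J_def by (simp add: power2_diff)
  qed
  define I where "I = Inf (range J)"
  have bdd: "bdd_below (range J)" using low by (auto intro!: bdd_belowI)
  have Ilow: "I \<le> J u" for u unfolding I_def using bdd by (simp add: cInf_lower)
  have "\<exists>u. J u < I + 1 / real (Suc n)" for n
    using cInf_lessD[of "range J" "I + 1 / real (Suc n)"] unfolding I_def by auto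
  then obtain u where u: "\<And>n. J (u n) < I + 1 / real (Suc n)" by metis
  have par: "(norm (a - b))\<^sup>2 = 2 * J a + 2 * J b - 4 * J ((a + b) /\<^sub>R 2)" for a b
    unfolding J_def by (simp add: scaleR add power2_norm_eq_inner inner_add_left inner_add_right
        inner_diff_left inner_diff_right inner_commute field_simps)
  have dist: "(norm (u m - u n))\<^sup>2 \<le> 2 * (1 / real (Suc m)) + 2 * (1 / real (Suc n))" for m n
    using par[of "u m" "u n"] u[of m] u[of n] Ilow[of "(u m + u n) /\<^sub>R 2"] by linarith
  have "Cauchy u"
  proof (rule metric_CauchyI)
    fix e :: real assume "e > 0"
    then obtain N where N: "inverse (real (Suc N)) < e\<^sup>2 / 4" using reals_Archimedean[of "e\<^sup>2/4"] by auto
    have "dist (u m) (u n) < e" if "m \<ge> N" "n \<ge> N" for m n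
    proof -
      have "1 / real (Suc m) \<le> 1 / real (Suc N)" "1 / real (Suc n) \<le> 1 / real (Suc N)"
        using that by (simp_all add: frac_le)
      with N dist[of m n] have "(norm (u m - u n))\<^sup>2 < e\<^sup>2" by (simp add: inverse_eq_divide)
      thus ?thesis using \<open>e > 0\<close> by (simp add: dist_norm power2_less_imp_less)
    qed
    thus "\<exists>M. \<forall>m\<ge>M. \<forall>n\<ge>M. dist (u m) (u n) < e" by blast
  qed
  then obtain r where r: "u \<longlonglongrightarrow> r" using Cauchy_convergent convergent_def by blast
  have "(\<lambda>n. J (u n)) \<longlonglongrightarrow> J r"
    unfolding J_def by (intro tendsto_intros tendsto r)
  moreover have "(\<lambda>n. I + 1 / real (Suc n)) \<longlonglongrightarrow> I"
    using tendsto_add[OF tendsto_const LIMSEQ_inverse_real_of_nat, of I] by (simp add: inverse_eq_divide)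
  ultimately have "J r \<le> I" by (rule LIMSEQ_le) (use u less_imp_le in blast)
  hence Jmin: "J r \<le> J w" for w using Ilow[of w] by linarith
  have "\<phi> y = inner r y" for y
  proof -
    define c where "c = inner r y - \<phi> y"
    have ineq: "0 \<le> t\<^sup>2 * (norm y)\<^sup>2 + 2 * t * c" for t
    proof -
      have "(norm (r + t *\<^sub>R y))\<^sup>2 = (norm r)\<^sup>2 + 2 * t * inner r y + t\<^sup>2 * (norm y)\<^sup>2"
        by (simp only: power2_norm_eq_inner) (simp add: inner_add_left inner_add_right inner_commute power2_eq_square)
      thus ?thesis using Jmin[of "r + t *\<^sub>R y"] unfolding J_def c_def
        by (simp add: add scaleR algebra_simps)
    qed
    show ?thesis
    proof (cases "y = 0")
      case True
      thus ?thesis using zero by simp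
    next
      case False
      hence y: "(norm y)\<^sup>2 > 0" by simp
      have "(- c / (norm y)\<^sup>2)\<^sup>2 * (norm y)\<^sup>2 + 2 * (- c / (norm y)\<^sup>2) * c = - (c\<^sup>2 / (norm y)\<^sup>2)"
        using y by (simp add: field_simps power2_eq_square)
      with ineq[of "- c / (norm y)\<^sup>2"] have "c\<^sup>2 / (norm y)\<^sup>2 \<le> 0" by linarith
      hence "c = 0" using y by (simp add: divide_le_0_iff)
      thus ?thesis by (simp add: c_def)
    qed
  qed
  thus ?thesis using that by blast
qed

text \<open>\<open>adjoint\<close> is defined by choice, so its defining identity is available only
  once an adjoint is known to exist; the Riesz representation provides one.\<close>

lemma inner_adjoint_hilbert:
  fixes B :: "'a::{real_inner, banach} \<Rightarrow>\<^sub>L 'b::real_inner"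
  shows "inner w (adjoint (blinfun_apply B) z) = inner (B w) z"
proof -
  have "\<exists>r. \<forall>w. inner (B w) z = inner w r" for z
  proof -
    have "bounded_linear (\<lambda>w. inner (B w) z)"
      by (intro bounded_linear_compose[OF bounded_linear_inner_left] blinfun.bounded_linear_right)
    then obtain r where "\<And>w. inner (B w) z = inner r w" by (rule riesz_representation) blast
    thus ?thesis by (metis inner_commute)
  qed
  then obtain R where "\<And>z w. inner (B w) z = inner w (R z)" by metis
  hence "adjoint (blinfun_apply B) = R" and "inner (B w) z = inner w (R z)"
    by (auto intro: adjoint_unique)
  thus ?thesis by simp
qed

section \<open>Remainder estimates along segments of the domain\<close>

lemma segment_interior:
  fixes D :: "'a::real_normed_vector set"
  assumes "convex D" "x \<in> interior D" "y \<in> D" "0 \<le> t" "t < 1"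
  shows "x + t *\<^sub>R (y - x) \<in> interior D"
proof -
  obtain r where r: "r > 0" "ball x r \<subseteq> D" using assms(2) by (auto simp: mem_interior)
  \<comment> \<open>The homothety centred at y with ratio 1 - t maps the ball around x onto this
    ball; q is the preimage of p.\<close>
  have "ball (x + t *\<^sub>R (y - x)) ((1 - t) * r) \<subseteq> D"
  proof
    fix p assume p: "p \<in> ball (x + t *\<^sub>R (y - x)) ((1 - t) * r)"
    define q where "q = x + (p - (x + t *\<^sub>R (y - x))) /\<^sub>R (1 - t)"
    have "norm (q - x) < r"
      using p assms(5) by (simp add: q_def dist_norm norm_minus_commute divide_simps mult.commute)
    hence "q \<in> D" using r by (auto simp: dist_norm norm_minus_commute)
    hence "(1 - t) *\<^sub>R q + t *\<^sub>R y \<in> D" using assms by (intro convexD) auto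
    moreover have "(1 - t) *\<^sub>R q + t *\<^sub>R y = p"
      using assms(5) by (simp add: q_def scaleR_right_distrib) (simp add: algebra_simps)
    ultimately show "p \<in> D" by simp
  qed
  thus ?thesis using r(1) assms(5) unfolding mem_interior by (intro exI[of _ "(1 - t) * r"]) simp
qed

text \<open>The change of the derivative grows at most linearly along the segment, whence the factor
  1/2 after integration. The end y may be a boundary point of D: derivatives are taken only at
  parameters below 1, and continuity of A covers the end.\<close>

lemma first_order_remainder:
  fixes A :: "'a::real_normed_vector \<Rightarrow> 'b::real_normed_vector"
  assumes D: "convex D" and cont: "continuous_on D A"
    and der: "\<And>x. x \<in> interior D \<Longrightarrow> (A has_derivative blinfun_apply (A' x)) (at x)"
    and lip: "\<And>x x'. x \<in> interior D \<Longrightarrow> x' \<in> interior D \<Longrightarrow> norm (A' x - A' x') \<le> C0 * norm (x - x')"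
    and x: "x \<in> interior D" and y: "y \<in> D"
  shows "norm (A y - A x - A' x (y - x)) \<le> C0 * (norm (y - x))\<^sup>2 / 2"
proof -
  define h where "h = y - x"
  define F where "F t = A (x + t *\<^sub>R h) - t *\<^sub>R A' x h" for t :: real
  have seg: "x + t *\<^sub>R h \<in> interior D" if "0 \<le> t" "t < 1" for t
    using segment_interior[OF D x y that] by (simp add: h_def)
  have segD: "x + t *\<^sub>R h \<in> D" if "0 \<le> t" "t \<le> 1" for t
    using seg[of t] that y interior_subset by (cases "t = 1") (auto simp: h_def)
  have "norm (F 1 - F 0) \<le> C0 * (norm h)\<^sup>2 * 1\<^sup>2 / 2 - C0 * (norm h)\<^sup>2 * 0\<^sup>2 / 2"
  proof (rule differentiable_bound_general[where f' = "\<lambda>t. A' (x + t *\<^sub>R h) h - A' x h"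
        and \<phi>' = "\<lambda>t. C0 * (norm h)\<^sup>2 * t"])
    show "continuous_on {0..1} F" unfolding F_def
      by (intro continuous_intros continuous_on_compose2[OF cont]) (use segD in auto)
    show "continuous_on {0..1} (\<lambda>t. C0 * (norm h)\<^sup>2 * t\<^sup>2 / 2)" by (intro continuous_intros) auto
    fix t :: real assume t: "0 < t" "t < 1"
    have "(A has_derivative blinfun_apply (A' (x + t *\<^sub>R h))) (at (x + t *\<^sub>R h))"
      using der seg t by simp
    moreover have "((\<lambda>t. x + t *\<^sub>R h) has_derivative (\<lambda>s. s *\<^sub>R h)) (at t)"
      by (auto intro!: derivative_eq_intros)
    ultimately have "((\<lambda>t. A (x + t *\<^sub>R h)) has_derivative (\<lambda>s. A' (x + t *\<^sub>R h) (s *\<^sub>R h))) (at t)"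
      using has_derivative_compose by blast
    hence "((\<lambda>t. A (x + t *\<^sub>R h)) has_vector_derivative A' (x + t *\<^sub>R h) h) (at t)"
      by (simp add: has_vector_derivative_def blinfun.scaleR_right)
    thus "(F has_vector_derivative A' (x + t *\<^sub>R h) h - A' x h) (at t)"
      unfolding F_def by (auto intro!: derivative_eq_intros)
    show "((\<lambda>t. C0 * (norm h)\<^sup>2 * t\<^sup>2 / 2) has_vector_derivative C0 * (norm h)\<^sup>2 * t) (at t)"
      unfolding has_real_derivative_iff_has_vector_derivative[symmetric]
      by (auto intro!: derivative_eq_intros)
    have "norm (A' (x + t *\<^sub>R h) h - A' x h) \<le> norm (A' (x + t *\<^sub>R h) - A' x) * norm h"
      using norm_blinfun[of "A' (x + t *\<^sub>R h) - A' x" h] by (simp add: blinfun.diff_left)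
    also have "\<dots> \<le> (C0 * norm (t *\<^sub>R h)) * norm h"
      using lip[OF seg[of t] x] t by (intro mult_right_mono) auto
    finally show "norm (A' (x + t *\<^sub>R h) h - A' x h) \<le> C0 * (norm h)\<^sup>2 * t"
      using t by (simp add: power2_eq_square mult_ac)
  qed auto
  thus ?thesis by (simp add: F_def h_def algebra_simps)
qed

text \<open>Both ends are expanded at the intermediate point; in the convex combination the
  derivative terms cancel. Unlike for an expansion at x, the error vanishes as t tends to 1, so it
  is useful close to the minimizer.\<close>

lemma chord_bound:
  fixes A :: "'a::real_normed_vector \<Rightarrow> 'b::real_normed_vector"
  assumes conv: "convex D" and cont: "continuous_on D A"
    and der: "\<And>x. x \<in> interior D \<Longrightarrow> (A has_derivative blinfun_apply (A' x)) (at x)"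
    and lip: "\<And>x x'. x \<in> interior D \<Longrightarrow> x' \<in> interior D \<Longrightarrow> norm (A' x - A' x') \<le> C0 * norm (x - x')"
    and x: "x \<in> interior D" and y: "y \<in> D" and t: "0 \<le> t" "t < 1"
  shows "norm (A (x + t *\<^sub>R (y - x)) - A x - t *\<^sub>R (A y - A x)) \<le> C0 * (norm (y - x))\<^sup>2 * (t * (1 - t)) / 2"
proof -
  have rem: "norm (A q - A p - A' p (q - p)) \<le> C0 * (norm (q - p))\<^sup>2 / 2" if "p \<in> interior D" "q \<in> D" for p q
    using conv cont der lip that by (rule first_order_remainder)
  define h p where "h = y - x" and "p = x + t *\<^sub>R h"
  have p: "p \<in> interior D" unfolding p_def h_def by (rule segment_interior[OF conv x y t])
  have px: "x - p = (- t) *\<^sub>R h" and py: "y - p = (1 - t) *\<^sub>R h"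
    by (simp_all add: p_def h_def algebra_simps)
  define r1 r2 where "r1 = A x - A p - A' p (x - p)" and "r2 = A y - A p - A' p (y - p)"
  have r1: "norm r1 \<le> C0 * (t\<^sup>2 * (norm h)\<^sup>2) / 2"
    using rem[OF p, of x] x interior_subset unfolding r1_def px by (auto simp: power_mult_distrib)
  have r2: "norm r2 \<le> C0 * ((1 - t)\<^sup>2 * (norm h)\<^sup>2) / 2"
    using rem[OF p y] t unfolding r2_def py by (simp add: power_mult_distrib)
  have "A p - A x - t *\<^sub>R (A y - A x) = - ((1 - t) *\<^sub>R r1 + t *\<^sub>R r2)"
  proof -
    have "A' p (x - p) = (- t) *\<^sub>R A' p h" and yp: "A' p (y - p) = (1 - t) *\<^sub>R A' p h"
      unfolding px py by (simp_all only: blinfun.scaleR_right)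
    hence "(1 - t) *\<^sub>R A' p (x - p) + t *\<^sub>R A' p (y - p) = 0" by simp
    thus ?thesis unfolding r1_def r2_def by (simp add: algebra_simps)
  qed
  hence "norm (A p - A x - t *\<^sub>R (A y - A x)) \<le> norm ((1 - t) *\<^sub>R r1) + norm (t *\<^sub>R r2)"
    using norm_triangle_ineq by (metis norm_minus_cancel)
  also have "\<dots> = (1 - t) * norm r1 + t * norm r2" using t by simp
  also have "\<dots> \<le> (1 - t) * (C0 * (t\<^sup>2 * (norm h)\<^sup>2) / 2) + t * (C0 * ((1 - t)\<^sup>2 * (norm h)\<^sup>2) / 2)"
    using r1 r2 t by (intro add_mono mult_left_mono) auto
  also have "\<dots> = C0 * (norm h)\<^sup>2 * (t * (1 - t)) / 2"
    by (simp add: power2_eq_square field_simps)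
  finally show ?thesis by (simp add: p_def h_def)
qed

text \<open>After division by \<open>\<alpha> * \<beta>\<close> this is
  \<open>tikhonov_core\<close>, whose \<open>h2\<close> comes from the Taylor remainder at x and
  whose \<open>h1\<close> comes from the chord bound near the minimizer.\<close>

lemma tikhonov_error_bound:
  fixes A :: "'a::{real_inner, banach} \<Rightarrow> 'b::real_inner"
  assumes conv: "convex D" and cont: "continuous_on D A"
    and der: "\<And>x. x \<in> interior D \<Longrightarrow> (A has_derivative blinfun_apply (A' x)) (at x)"
    and lip: "\<And>x x'. x \<in> interior D \<Longrightarrow> x' \<in> interior D \<Longrightarrow> norm (A' x - A' x') \<le> C0 * norm (x - x')"
    and C0: "C0 > 0" and \<beta>: "\<beta> > 0" and \<alpha>: "\<alpha> > 0"
    and x: "x \<in> interior D" and src: "x - x0 = adjoint (blinfun_apply (A' x)) z" and z: "norm z \<le> \<beta>"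
    and min: "is_arg_min (tikhonov A \<alpha> (A x + err) x0) (\<lambda>x. x \<in> D) \<xi>"
  shows "\<alpha> * (1 - \<beta> * C0) * (norm (\<xi> - x))\<^sup>2 \<le> (norm err)\<^sup>2 + 2/3 * (\<alpha> * \<beta>)\<^sup>2"
proof -
  define w c where "w = \<xi> - x" and "c = \<alpha> * \<beta>"
  have c: "c > 0" using \<alpha> \<beta> by (simp add: c_def)
  define a where "a t = (A (x + t *\<^sub>R w) - A x) /\<^sub>R c" for t
  define b d e where "b = A' x w /\<^sub>R c" and "d = (A \<xi> - A x) /\<^sub>R c" and "e = err /\<^sub>R c"
  define S g where "S = \<alpha> * (norm w)\<^sup>2 / c\<^sup>2" and "g = C0 * (norm w)\<^sup>2 / c"
  have g0: "g \<ge> 0" using C0 c by (simp add: g_def)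
  have \<xi>: "\<xi> \<in> D" and opt: "\<And>y. y \<in> D \<Longrightarrow> tikhonov A \<alpha> (A x + err) x0 \<xi> \<le> tikhonov A \<alpha> (A x + err) x0 y"
    using min by (auto simp: is_arg_min_def not_less)
  have seg: "x + t *\<^sub>R w \<in> interior D" if "0 \<le> t" "t < 1" for t
    unfolding w_def by (rule segment_interior[OF conv x \<xi> that])
  have segD: "x + t *\<^sub>R w \<in> D" if "0 \<le> t" "t \<le> 1" for t
    using seg[of t] that \<xi> interior_subset by (cases "t = 1") (auto simp: w_def)
  have rem: "norm (A q - A x - A' x (q - x)) \<le> C0 * (norm (q - x))\<^sup>2 / 2" if "q \<in> D" for q
    using conv cont der lip x that by (rule first_order_remainder)
  have chord: "norm (A (x + t *\<^sub>R (\<xi> - x)) - A x - t *\<^sub>R (A \<xi> - A x)) \<le> C0 * (norm (\<xi> - x))\<^sup>2 * (t * (1 - t)) / 2"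
    if "0 \<le> t" "t < 1" for t
    using conv cont der lip x \<xi> that by (rule chord_bound)
  \<comment> \<open>The minimizer is compared with the point at parameter t. The source condition
    moves the linear term onto the derivative of A, where norm z \<le> \<beta> bounds it.\<close>
  have H: "S * (1 - t\<^sup>2) \<le> 2 * norm b * (1 - t) + (norm (a t - e))\<^sup>2 - (norm (d - e))\<^sup>2"
    if t: "0 \<le> t" "t \<le> 1" for t
  proof -
    define k where "k = inner w (x - x0)"
    have k: "k = inner (A' x w) z" unfolding k_def src by (rule inner_adjoint_hilbert)
    have exp: "(norm (x + s *\<^sub>R w - x0))\<^sup>2 = (norm (x - x0))\<^sup>2 + 2 * s * k + s\<^sup>2 * (norm w)\<^sup>2" for s
    proof -
      have "x + s *\<^sub>R w - x0 = (x - x0) + s *\<^sub>R w" by simp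
      thus ?thesis unfolding k_def
        by (simp only: power2_norm_eq_inner) (simp add: inner_add_left inner_add_right inner_commute power2_eq_square)
    qed
    have "(norm (A \<xi> - (A x + err)))\<^sup>2 + \<alpha> * (norm (\<xi> - x0))\<^sup>2
        \<le> (norm (A (x + t *\<^sub>R w) - (A x + err)))\<^sup>2 + \<alpha> * (norm (x + t *\<^sub>R w - x0))\<^sup>2"
      using opt[OF segD[OF t]] by (simp add: tikhonov_def)
    moreover have "A \<xi> - (A x + err) = c *\<^sub>R (d - e)" "A (x + t *\<^sub>R w) - (A x + err) = c *\<^sub>R (a t - e)"
      using c by (simp_all add: d_def e_def a_def algebra_simps)
    moreover have "(norm (\<xi> - x0))\<^sup>2 = (norm (x - x0))\<^sup>2 + 2 * k + (norm w)\<^sup>2"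
      using exp[of 1] by (simp add: w_def)
    moreover have "(norm (c *\<^sub>R u))\<^sup>2 = c\<^sup>2 * (norm u)\<^sup>2" for u :: 'b by (simp add: power_mult_distrib)
    ultimately have "c\<^sup>2 * (norm (d - e))\<^sup>2 + \<alpha> * (2 * k + (norm w)\<^sup>2)
        \<le> c\<^sup>2 * (norm (a t - e))\<^sup>2 + \<alpha> * (2 * t * k + t\<^sup>2 * (norm w)\<^sup>2)"
      unfolding exp by (simp only:) (simp add: algebra_simps)
    hence "\<alpha> * (norm w)\<^sup>2 * (1 - t\<^sup>2) \<le> c\<^sup>2 * ((norm (a t - e))\<^sup>2 - (norm (d - e))\<^sup>2) + 2 * (1 - t) * (\<alpha> * (- k))"
      by (simp add: algebra_simps)
    also have "\<dots> \<le> c\<^sup>2 * ((norm (a t - e))\<^sup>2 - (norm (d - e))\<^sup>2) + 2 * (1 - t) * (c\<^sup>2 * norm b)"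
    proof -
      have "- k \<le> norm (A' x w) * norm z" using Cauchy_Schwarz_ineq2[of "A' x w" z] by (simp add: k)
      also have "\<dots> \<le> norm (A' x w) * \<beta>" using z by (intro mult_left_mono) auto
      finally have "\<alpha> * (- k) \<le> \<alpha> * (norm (A' x w) * \<beta>)" using \<alpha> by (intro mult_left_mono) auto
      also have "\<dots> = c\<^sup>2 * norm b" using c by (simp add: b_def c_def power2_eq_square field_simps)
      finally show ?thesis using t by (intro add_left_mono mult_left_mono) auto
    qed
    also have "\<dots> = c\<^sup>2 * (2 * norm b * (1 - t) + (norm (a t - e))\<^sup>2 - (norm (d - e))\<^sup>2)"
      by (simp add: algebra_simps)
    finally have "\<alpha> * (norm w)\<^sup>2 * (1 - t\<^sup>2) \<le> c\<^sup>2 * (2 * norm b * (1 - t) + (norm (a t - e))\<^sup>2 - (norm (d - e))\<^sup>2)" .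
    moreover have "\<alpha> * (norm w)\<^sup>2 = c\<^sup>2 * S" using c by (simp add: S_def)
    ultimately have "c\<^sup>2 * (S * (1 - t\<^sup>2)) \<le> c\<^sup>2 * (2 * norm b * (1 - t) + (norm (a t - e))\<^sup>2 - (norm (d - e))\<^sup>2)"
      by (simp only: mult.assoc)
    thus ?thesis by (rule mult_left_le_imp_le) (use c in simp)
  qed
  have taylor: "norm (a t - t *\<^sub>R b) \<le> g * t\<^sup>2 / 2" if t: "0 \<le> t" "t \<le> 1" for t
  proof -
    have "norm (A (x + t *\<^sub>R w) - A x - A' x (t *\<^sub>R w)) \<le> C0 * (t\<^sup>2 * (norm w)\<^sup>2) / 2"
      using rem[OF segD[OF t]] t by (simp add: power_mult_distrib)
    moreover have "a t - t *\<^sub>R b = (A (x + t *\<^sub>R w) - A x - A' x (t *\<^sub>R w)) /\<^sub>R c"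
      by (simp add: a_def b_def blinfun.scaleR_right algebra_simps)
    ultimately show ?thesis using c by (simp add: g_def divide_simps mult_ac)
  qed
  have a0: "a 0 = 0" and a1: "a 1 = d" by (simp_all add: a_def d_def w_def)
  have "S - g \<le> (norm e)\<^sup>2 + 2/3"
  proof (rule tikhonov_core[of g S b e d])
    show "0 \<le> g" by (rule g0)
    show "S \<le> 2 * norm b + (norm e)\<^sup>2 - (norm (d - e))\<^sup>2" using H[of 0] by (simp add: a0)
    show "norm (d - b) \<le> g / 2" using taylor[of 1] by (simp add: a1)
    show "S * (1 - t\<^sup>2) \<le> 2 * norm b * (1 - t) + (norm (t *\<^sub>R b - e) + g * t\<^sup>2 / 2)\<^sup>2 - (norm (d - e))\<^sup>2"
      if t: "0 \<le> t" "t \<le> 1" for t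
    proof -
      have "norm (a t - e) \<le> norm (t *\<^sub>R b - e) + norm (a t - t *\<^sub>R b)"
        using norm_triangle_ineq[of "t *\<^sub>R b - e" "a t - t *\<^sub>R b"] by simp
      hence "norm (a t - e) \<le> norm (t *\<^sub>R b - e) + g * t\<^sup>2 / 2" using taylor[OF t] by linarith
      hence "(norm (a t - e))\<^sup>2 \<le> (norm (t *\<^sub>R b - e) + g * t\<^sup>2 / 2)\<^sup>2" by (intro power_mono) auto
      thus ?thesis using H[OF t] by linarith
    qed
    show "S \<le> norm b + inner d (e - d) + g * norm (d - e) / 2"
    proof -
      \<comment> \<open>The minimizer may lie on the boundary of D, where A need not be
        differentiable. The chord bound replaces the derivative: the factor 1 - t is divided out,
        and t then tends to 1 from below.\<close>
      have ineq: "S * (1 + t) \<le> 2 * norm b + (norm e)\<^sup>2 - (norm (d - e))\<^sup>2 - t * (norm d)\<^sup>2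
          + g * t * norm (t *\<^sub>R d - e) + g\<^sup>2 * t\<^sup>2 * (1 - t) / 4" if t: "0 < t" "t < 1" for t
      proof -
        have "norm (A (x + t *\<^sub>R w) - A x - t *\<^sub>R (A \<xi> - A x)) \<le> C0 * (norm w)\<^sup>2 * (t * (1 - t)) / 2"
          using chord[of t] t unfolding w_def by simp
        moreover have "a t - t *\<^sub>R d = (A (x + t *\<^sub>R w) - A x - t *\<^sub>R (A \<xi> - A x)) /\<^sub>R c"
          by (simp add: a_def d_def algebra_simps)
        ultimately have "norm (a t - t *\<^sub>R d) \<le> g * (t * (1 - t)) / 2"
          using c by (simp add: g_def divide_simps mult_ac)
        moreover have "norm (a t - e) \<le> norm (t *\<^sub>R d - e) + norm (a t - t *\<^sub>R d)"
          using norm_triangle_ineq[of "t *\<^sub>R d - e" "a t - t *\<^sub>R d"] by simp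
        ultimately have "norm (a t - e) \<le> norm (t *\<^sub>R d - e) + g * (t * (1 - t)) / 2" by linarith
        hence "(norm (a t - e))\<^sup>2 \<le> (norm (t *\<^sub>R d - e) + g * (t * (1 - t)) / 2)\<^sup>2"
          by (intro power_mono) auto
        also have "\<dots> = (norm (t *\<^sub>R d - e))\<^sup>2 + (1 - t) * (g * t * norm (t *\<^sub>R d - e) + g\<^sup>2 * t\<^sup>2 * (1 - t) / 4)"
          by (simp add: power2_eq_square field_simps)
        \<comment> \<open>Stewart's identity for a point between -e and d - e, arranged to show the
          factor 1 - t.\<close>
        also have "(norm (t *\<^sub>R d - e))\<^sup>2
            = (norm (d - e))\<^sup>2 + (1 - t) * ((norm e)\<^sup>2 - (norm (d - e))\<^sup>2 - t * (norm d)\<^sup>2)"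
          by (simp only: power2_norm_eq_inner)
            (simp add: inner_diff_left inner_diff_right inner_commute algebra_simps)
        finally have "(norm (a t - e))\<^sup>2 - (norm (d - e))\<^sup>2 \<le> (1 - t) * ((norm e)\<^sup>2 - (norm (d - e))\<^sup>2 - t * (norm d)\<^sup>2)
             + (1 - t) * (g * t * norm (t *\<^sub>R d - e) + g\<^sup>2 * t\<^sup>2 * (1 - t) / 4)" by simp
        hence "S * (1 - t\<^sup>2) \<le> 2 * norm b * (1 - t) + (1 - t) * ((norm e)\<^sup>2 - (norm (d - e))\<^sup>2 - t * (norm d)\<^sup>2)
             + (1 - t) * (g * t * norm (t *\<^sub>R d - e) + g\<^sup>2 * t\<^sup>2 * (1 - t) / 4)" using H[of t] t by linarith
        moreover have "S * (1 - t\<^sup>2) = (1 - t) * (S * (1 + t))" by (simp add: power2_eq_square algebra_simps)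
        moreover have "2 * norm b * (1 - t) + (1 - t) * u + (1 - t) * v = (1 - t) * (2 * norm b + u + v)" for u v
          by (simp add: algebra_simps)
        ultimately have "(1 - t) * (S * (1 + t)) \<le> (1 - t) * (2 * norm b + ((norm e)\<^sup>2 - (norm (d - e))\<^sup>2 - t * (norm d)\<^sup>2)
          + (g * t * norm (t *\<^sub>R d - e) + g\<^sup>2 * t\<^sup>2 * (1 - t) / 4))" by simp
        thus ?thesis using t by simp
      qed
      define F where "F t = 2 * norm b + (norm e)\<^sup>2 - (norm (d - e))\<^sup>2 - t * (norm d)\<^sup>2
          + g * t * norm (t *\<^sub>R d - e) + g\<^sup>2 * t\<^sup>2 * (1 - t) / 4" for t
      have "S * (1 + 1) \<le> F 1"
      proof (rule tendsto_le[of "at_left (1::real)" F "F 1" "\<lambda>t. S * (1 + t)"])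
        have "isCont F 1" unfolding F_def by (intro continuous_intros) auto
        thus "(F \<longlongrightarrow> F 1) (at_left 1)" by (simp add: isCont_def filterlim_at_split)
        show "((\<lambda>t. S * (1 + t)) \<longlongrightarrow> S * (1 + 1)) (at_left 1)" by (intro tendsto_intros)
        show "\<forall>\<^sub>F t in at_left 1. S * (1 + t) \<le> F t"
          unfolding F_def eventually_at_left_field by (intro exI[of _ 0]) (use ineq in auto)
      qed simp
      moreover have "(norm e)\<^sup>2 - (norm (d - e))\<^sup>2 - (norm d)\<^sup>2 = 2 * inner d (e - d)"
        by (simp add: power2_norm_eq_inner inner_diff_left inner_diff_right inner_commute)
      ultimately show ?thesis unfolding F_def by simp
    qed
  qed
  hence "c\<^sup>2 * (S - g) \<le> c\<^sup>2 * ((norm e)\<^sup>2 + 2/3)" by (intro mult_left_mono) auto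
  moreover have "c\<^sup>2 * (S - g) = \<alpha> * (1 - \<beta> * C0) * (norm w)\<^sup>2"
    using c by (simp add: S_def g_def right_diff_distrib power2_eq_square) (simp add: c_def algebra_simps)
  moreover have "c\<^sup>2 * ((norm e)\<^sup>2 + 2/3) = (norm err)\<^sup>2 + 2/3 * c\<^sup>2"
    using c by (simp add: e_def power_mult_distrib power_divide field_simps)
  ultimately show ?thesis by (simp add: w_def c_def)
qed

section \<open>Deviation of empirical means\<close>

lemma powr_le_chord:
  fixes k y :: real
  assumes "k > 0" "0 \<le> y" "y \<le> 1"
  shows "k powr y \<le> 1 + y * (k - 1)"
proof -
  have "exp ((1 - y) *\<^sub>R 0 + y *\<^sub>R ln k) \<le> (1 - y) * exp 0 + y * exp (ln k)"
    using assms by (intro convex_onD[OF exp_convex]) auto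
  thus ?thesis using assms by (simp add: powr_def algebra_simps)
qed

lemma (in prob_space) prob_prod_ge_1_le:
  fixes W :: "'i \<Rightarrow> 'a \<Rightarrow> real"
  assumes fin: "finite I" and ind: "indep_vars (\<lambda>_. borel) W I"
    and nonneg: "\<And>i \<omega>. i \<in> I \<Longrightarrow> \<omega> \<in> space M \<Longrightarrow> 0 \<le> W i \<omega>"
    and int: "\<And>i. i \<in> I \<Longrightarrow> integrable M (W i)"
    and c: "\<And>i. i \<in> I \<Longrightarrow> expectation (W i) \<le> c"
  shows "prob {\<omega> \<in> space M. 1 \<le> (\<Prod>i\<in>I. W i \<omega>)} \<le> c ^ card I"
proof -
  have "prob {\<omega> \<in> space M. 1 \<le> (\<Prod>i\<in>I. W i \<omega>)} \<le> expectation (\<lambda>\<omega>. \<Prod>i\<in>I. W i \<omega>) / 1"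
    by (intro integral_Markov_inequality_measure[where A = "{}"])
      (use fin int nonneg in \<open>auto intro!: indep_vars_integrable[OF fin ind] prod_nonneg AE_I2\<close>)
  also have "\<dots> = (\<Prod>i\<in>I. expectation (W i))"
    using indep_vars_lebesgue_integral[OF fin ind int] by simp
  also have "\<dots> \<le> (\<Prod>i\<in>I. c)"
    using c nonneg by (intro prod_mono) (auto intro!: Bochner_Integration.integral_nonneg)
  finally show ?thesis by simp
qed

text \<open>
  Chernoff's method with the factor \<open>sqrt (p / r)\<close>: by convexity the worst case of
  \<open>E[(p/r) powr ((V - U)/2)]\<close> is attained by indicator functions of disjoint events.
\<close>

lemma (in prob_space) prob_sum_le_sum:
  fixes U V :: "'i \<Rightarrow> 'a \<Rightarrow> real"
  assumes fin: "finite I"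
    and ind: "indep_vars (\<lambda>_. borel \<Otimes>\<^sub>M borel) (\<lambda>i \<omega>. (U i \<omega>, V i \<omega>)) I"
    and U: "\<And>i \<omega>. i \<in> I \<Longrightarrow> \<omega> \<in> space M \<Longrightarrow> U i \<omega> \<in> {0..1}"
    and V: "\<And>i \<omega>. i \<in> I \<Longrightarrow> \<omega> \<in> space M \<Longrightarrow> V i \<omega> \<in> {0..1}"
    and EU: "\<And>i. i \<in> I \<Longrightarrow> p \<le> expectation (U i)"
    and EV: "\<And>i. i \<in> I \<Longrightarrow> expectation (V i) \<le> r"
    and r: "0 < r" and rp: "r \<le> p"
  shows "prob {\<omega> \<in> space M. (\<Sum>i\<in>I. U i \<omega>) \<le> (\<Sum>i\<in>I. V i \<omega>)}
    \<le> exp (- real (card I) * (sqrt p - sqrt r)\<^sup>2)"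
proof -
  define k where "k = sqrt p / sqrt r"
  have k1: "1 \<le> k" using r rp by (simp add: k_def)
  define W where "W i \<omega> = k powr (V i \<omega> - U i \<omega>)" for i \<omega>
  have meas: "U i \<in> borel_measurable M" "V i \<in> borel_measurable M" if "i \<in> I" for i
  proof -
    have "(\<lambda>\<omega>. (U i \<omega>, V i \<omega>)) \<in> M \<rightarrow>\<^sub>M borel \<Otimes>\<^sub>M borel"
      using ind that by (auto simp: indep_vars_def)
    from measurable_compose[OF this measurable_fst] measurable_compose[OF this measurable_snd]
    show "U i \<in> borel_measurable M" "V i \<in> borel_measurable M" by simp_all
  qed
  have intU: "integrable M (U i)" and intV: "integrable M (V i)" if "i \<in> I" for i
    using meas[OF that] U[OF that] V[OF that]
    by (auto intro!: integrable_const_bound[where B = 1] AE_I2)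
  have Wmeas: "W i \<in> borel_measurable M" if "i \<in> I" for i
    unfolding W_def[abs_def] using meas[OF that] by measurable
  have Wle: "W i \<omega> \<le> 1 + V i \<omega> * (k - 1) - U i \<omega> * (1 - 1/k)" if "i \<in> I" "\<omega> \<in> space M" for i \<omega>
  proof -
    have u: "0 \<le> U i \<omega>" "U i \<omega> \<le> 1" and v: "0 \<le> V i \<omega>" "V i \<omega> \<le> 1" using U V that by auto
    have "W i \<omega> = k powr (V i \<omega>) * (1/k) powr (U i \<omega>)"
      using k1 by (simp add: W_def powr_diff powr_divide)
    \<comment> \<open>Each power is bounded by its chord; the mixed term of the product is
      nonpositive and is dropped.\<close>
    also have "\<dots> \<le> (1 + V i \<omega> * (k - 1)) * (1 + U i \<omega> * (1/k - 1))"
      using k1 u v by (intro mult_mono powr_le_chord) auto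
    also have "\<dots> = 1 + V i \<omega> * (k - 1) - U i \<omega> * (1 - 1/k) - (V i \<omega> * (k - 1)) * (U i \<omega> * (1 - 1/k))"
      by (simp add: algebra_simps)
    also have "\<dots> \<le> 1 + V i \<omega> * (k - 1) - U i \<omega> * (1 - 1/k)"
      using k1 u v by simp
    finally show ?thesis .
  qed
  have Wint: "integrable M (W i)" if "i \<in> I" for i
  proof (rule integrable_const_bound[where B = "k"])
    show "AE \<omega> in M. norm (W i \<omega>) \<le> k"
    proof (rule AE_I2)
      fix \<omega> assume w: "\<omega> \<in> space M"
      have "k powr (V i \<omega> - U i \<omega>) \<le> k powr 1"
        using U[OF that w] V[OF that w] k1 by (intro powr_mono) auto
      thus "norm (W i \<omega>) \<le> k" using k1 by (simp add: W_def)
    qed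
  qed (rule Wmeas[OF that])
  \<comment> \<open>This k equalizes r * k and p / k, which minimizes their sum.\<close>
  have "p / k = p / sqrt p * sqrt r" "r * k = r / sqrt r * sqrt p" by (simp_all add: k_def)
  hence pr: "p / k = sqrt p * sqrt r" "r * k = sqrt p * sqrt r"
    using r rp by (simp_all add: real_div_sqrt)
  have EW: "expectation (W i) \<le> exp (- (sqrt p - sqrt r)\<^sup>2)" if i: "i \<in> I" for i
  proof -
    have "expectation (W i) \<le> expectation (\<lambda>\<omega>. 1 + V i \<omega> * (k - 1) - U i \<omega> * (1 - 1/k))"
      using Wle[OF i] Wint[OF i] intU[OF i] intV[OF i] by (intro integral_mono) auto
    also have "\<dots> = 1 + expectation (V i) * (k - 1) - expectation (U i) * (1 - 1/k)"
      using intU[OF i] intV[OF i] by (simp add: prob_space)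
    also have "\<dots> \<le> 1 + r * (k - 1) - p * (1 - 1/k)"
      using EU[OF i] EV[OF i] k1 by (intro add_mono diff_mono mult_right_mono) auto
    also have "\<dots> = 1 - (sqrt p - sqrt r)\<^sup>2"
    proof -
      have "r * (k - 1) - p * (1 - 1/k) = r * k + p / k - r - p" by (simp add: algebra_simps)
      thus ?thesis unfolding pr using r rp by (simp add: power2_diff)
    qed
    also have "\<dots> \<le> exp (- (sqrt p - sqrt r)\<^sup>2)"
      using exp_ge_add_one_self[of "- (sqrt p - sqrt r)\<^sup>2"] by simp
    finally show ?thesis .
  qed
  have indW: "indep_vars (\<lambda>_. borel) W I"
    using indep_vars_compose2[OF ind, of "\<lambda>_ x. k powr (snd x - fst x)" "\<lambda>_. borel"]
    by (simp add: W_def[abs_def])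
  have "{\<omega> \<in> space M. (\<Sum>i\<in>I. U i \<omega>) \<le> (\<Sum>i\<in>I. V i \<omega>)} \<subseteq> {\<omega> \<in> space M. 1 \<le> (\<Prod>i\<in>I. W i \<omega>)}"
  proof safe
    fix \<omega> assume le: "(\<Sum>i\<in>I. U i \<omega>) \<le> (\<Sum>i\<in>I. V i \<omega>)"
    have "(\<Prod>i\<in>I. W i \<omega>) = k powr (\<Sum>i\<in>I. V i \<omega> - U i \<omega>)"
      unfolding W_def using fin k1 by (simp add: powr_sum)
    also have "\<dots> \<ge> 1" using le k1 by (intro ge_one_powr_ge_zero) (simp_all add: sum_subtractf)
    finally show "1 \<le> (\<Prod>i\<in>I. W i \<omega>)" .
  qed
  moreover have "{\<omega> \<in> space M. 1 \<le> (\<Prod>i\<in>I. W i \<omega>)} \<in> sets M"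
    using Wmeas by measurable
  ultimately have "prob {\<omega> \<in> space M. (\<Sum>i\<in>I. U i \<omega>) \<le> (\<Sum>i\<in>I. V i \<omega>)}
      \<le> prob {\<omega> \<in> space M. 1 \<le> (\<Prod>i\<in>I. W i \<omega>)}"
    by (rule finite_measure_mono)
  also have "\<dots> \<le> exp (- (sqrt p - sqrt r)\<^sup>2) ^ card I"
    by (intro prob_prod_ge_1_le fin indW Wint EW) (simp add: W_def)
  also have "\<dots> = exp (- real (card I) * (sqrt p - sqrt r)\<^sup>2)"
    by (simp flip: exp_of_nat_mult)
  finally show ?thesis .
qed

section \<open>Truncation, conditional moments and the grid\<close>

lemma norm_trunc_le: "norm (trunc x) \<le> 1"
  by (simp add: trunc_def divide_simps)

lemma measurable_trunc [measurable]:
  "(trunc :: 'a::{real_inner, second_countable_topology} \<Rightarrow> 'a) \<in> borel_measurable borel"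
  unfolding trunc_def[abs_def] by measurable

text \<open>\<open>trunc\<close> is the metric projection onto the closed unit ball, which contains
  y. With s = norm x > 1 and inner x y \<le> s, the squared distances differ by at least (s -
  1)^2.\<close>

lemma norm_trunc_diff_le:
  fixes x y :: "'a::real_inner"
  assumes y: "norm y \<le> 1"
  shows "norm (trunc x - y) \<le> norm (x - y)"
proof (cases "norm x \<le> 1")
  case False
  define s where "s = norm x"
  have s: "s > 1" using False by (simp add: s_def)
  have "inner x y \<le> s * 1" unfolding s_def
    using norm_cauchy_schwarz[of x y] mult_left_mono[OF y, of "norm x"] by simp
  hence "inner x y / s \<le> 1" using s by simp
  hence "(s - 1) * (inner x y / s) \<le> (s - 1) * 1" using s by (intro mult_left_mono) auto
  hence "inner x y - inner x y / s \<le> s - 1" using s by (simp add: diff_divide_distrib left_diff_distrib)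
  moreover have "0 \<le> s\<^sup>2 - 2 * s + 1" using zero_le_power2[of "s - 1"] by (simp add: power2_diff)
  moreover have "(norm (x /\<^sub>R s - y))\<^sup>2 = 1 - 2 * (inner x y / s) + (norm y)\<^sup>2"
  proof -
    have "norm (x /\<^sub>R s) = \<bar>inverse s\<bar> * s" by (simp add: s_def)
    hence "norm (x /\<^sub>R s) = 1" using s by simp
    hence "inner (x /\<^sub>R s) (x /\<^sub>R s) = 1" by (simp only: dot_square_norm power_one)
    moreover have "inner (x /\<^sub>R s) y = inner x y / s" by (simp add: divide_inverse mult.commute)
    moreover have "(norm (x /\<^sub>R s - y))\<^sup>2 = inner (x /\<^sub>R s) (x /\<^sub>R s) - 2 * inner (x /\<^sub>R s) y + inner y y"
      unfolding power2_norm_eq_inner inner_diff_left inner_diff_right inner_commute[of y "x /\<^sub>R s"] by linarith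
    ultimately show ?thesis by (simp only: power2_norm_eq_inner)
  qed
  moreover have "(norm (x - y))\<^sup>2 = s\<^sup>2 - 2 * inner x y + (norm y)\<^sup>2"
    unfolding s_def power2_norm_eq_inner inner_diff_left inner_diff_right inner_commute[of y x] by linarith
  ultimately have "(norm (x /\<^sub>R s - y))\<^sup>2 \<le> (norm (x - y))\<^sup>2" by linarith
  hence "norm (x /\<^sub>R s - y) \<le> norm (x - y)" by (rule power2_le_imp_le) simp
  moreover have "trunc x = x /\<^sub>R s" using False by (simp add: trunc_def s_def)
  ultimately show ?thesis by simp
qed (simp add: trunc_def)

lemma trunc_loss_bounds: "0 \<le> trunc_loss x0 x x'" "trunc_loss x0 x x' \<le> 4"
proof -
  have "norm (trunc (x - x0) - trunc (x' - x0)) \<le> 2"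
    using norm_triangle_ineq4[of "trunc (x - x0)" "trunc (x' - x0)"] norm_trunc_le[of "x - x0"] norm_trunc_le[of "x' - x0"]
    by linarith
  from power_mono[OF this, of 2] show "trunc_loss x0 x x' \<le> 4" by (simp add: trunc_loss_def)
qed (simp add: trunc_loss_def)

text \<open>The tower property; it turns the conditional noise bound into a second moment
  bound.\<close>

lemma (in prob_space) nn_integral_le_of_nn_cond_exp_le:
  fixes X :: "'a \<Rightarrow> 'c::topological_space"
  assumes X: "X \<in> borel_measurable M" and g: "g \<in> borel_measurable M"
    and le: "AE \<omega> in M. nn_cond_exp M (vimage_algebra (space M) X borel) g \<omega> \<le> c"
  shows "(\<integral>\<^sup>+\<omega>. g \<omega> \<partial>M) \<le> c"
proof -
  let ?F = "vimage_algebra (space M) X borel"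
  have "subalgebra M ?F"
    using X by (simp add: subalgebra_def sets_image_in_sets)
  then interpret finite_measure_subalgebra M ?F
    by unfold_locales
  have "(\<integral>\<^sup>+\<omega>. g \<omega> \<partial>M) = (\<integral>\<^sup>+\<omega>. nn_cond_exp M ?F g \<omega> \<partial>M)"
    using nn_cond_exp_intg[of "\<lambda>_. 1" g] g by simp
  also have "\<dots> \<le> (\<integral>\<^sup>+\<omega>. c \<partial>M)" using le by (rule nn_integral_mono_AE)
  finally show ?thesis by (simp add: emeasure_space_1)
qed

text \<open>j is the index of the first grid point not below s. For j > 1 the preceding point lies
  below s and is smaller by a factor Q, so \<open>grid_constant\<close> selects one of the two; for
  j = 1 the range of s forces s = \<open>lam 1\<close>.\<close>

lemma geometric_grid_neighbour:
  fixes lam :: "nat \<Rightarrow> real"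
  assumes N: "N \<ge> 1" and lam1: "0 < lam 1" and Q: "1 \<le> Q"
    and geo: "\<And>j. j \<in> {1..N} \<Longrightarrow> lam j = lam 1 * Q ^ (j - 1)"
    and s: "s \<in> {lam 1..lam N}"
  shows "\<exists>j\<in>{1..N}. 0 < lam j \<and>
    13/11 * (1 / (lam j / s) + 2 * (lam j / s) / 3) \<le> (1 + Q)\<^sup>2 / (2 * Q)"
proof -
  have s0: "s > 0" using s lam1 by simp
  define j where "j = (LEAST j. j \<ge> 1 \<and> s \<le> lam j)"
  have j: "j \<ge> 1" "s \<le> lam j" and jN: "j \<le> N"
    using LeastI[of "\<lambda>j. j \<ge> 1 \<and> s \<le> lam j" N] Least_le[of "\<lambda>j. j \<ge> 1 \<and> s \<le> lam j" N] N s
    by (auto simp: j_def)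
  show ?thesis
  proof (cases "j = 1")
    case True
    hence "lam j / s = 1" using j s s0 by simp
    moreover have "13/11 * (1 / 1 + 2 * 1 / 3) \<le> (1 + Q)\<^sup>2 / (2 * Q)"
      using grid_constant_small[of 1 Q] Q by simp
    ultimately show ?thesis using True lam1 N by (intro bexI[of _ j]) auto
  next
    case False
    define i where "i = j - 1"
    have i: "i \<in> {1..N}" "j = Suc i" using False j jN by (auto simp: i_def)
    have "\<not> s \<le> lam i" using not_less_Least[of i "\<lambda>j. j \<ge> 1 \<and> s \<le> lam j", folded j_def] i by auto
    moreover have step: "lam j = lam i * Q"
      using geo[of i] geo[of j] i jN by (cases i) (auto simp: mult_ac)
    ultimately have "1 \<le> lam j / s" "lam j / s \<le> Q"
      using j s0 Q by (auto simp: divide_simps mult.commute intro!: mult_left_mono)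
    from grid_constant[OF this] show ?thesis
    proof
      assume "13/11 * (1 / (lam j / s) + 2 * (lam j / s) / 3) \<le> (1 + Q)\<^sup>2 / (2 * Q)"
      thus ?thesis using j jN s0 by (intro bexI[of _ j]) auto
    next
      have pos: "0 < lam i" using geo[OF i(1)] lam1 Q by simp
      have eqs: "lam i / s = lam j / s / Q" "1 / (lam i / s) = Q / (lam j / s)"
        using step Q pos s0 by (simp_all add: field_simps)
      assume "13/11 * (Q / (lam j / s) + 2 * (lam j / s / Q) / 3) \<le> (1 + Q)\<^sup>2 / (2 * Q)"
      hence "13/11 * (1 / (lam i / s) + 2 * (lam i / s) / 3) \<le> (1 + Q)\<^sup>2 / (2 * Q)" by (subst eqs(2), subst eqs(1))
      thus ?thesis using pos i(1) by (intro bexI[of _ i] conjI)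
    qed
  qed
qed

section \<open>The risk of the selected parameter\<close>

theorem corollary2:
  fixes M :: "'w measure"
    and D :: "'a::{real_inner, banach, second_countable_topology} set"
    and A :: "'a \<Rightarrow> 'b::{real_inner, banach, second_countable_topology}"
    and A' :: "'a \<Rightarrow> 'a \<Rightarrow>\<^sub>L 'b"
    and X X0 :: "'w \<Rightarrow> 'a"
    and \<epsilon> Y Z :: "'w \<Rightarrow> 'b"
    and \<tau> \<beta> C0 Q \<eta> :: real
    and N n :: nat
    and lam :: "nat \<Rightarrow> real"
    and f :: "real \<Rightarrow> 'b \<times> 'a \<Rightarrow> 'a"
    and Ys :: "nat \<Rightarrow> 'w \<Rightarrow> 'b"
    and Xs X0s :: "nat \<Rightarrow> 'w \<Rightarrow> 'a"
    and lam_hat :: "'w \<Rightarrow> real"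
  assumes "prob_space M"
    and "X \<in> borel_measurable M" and "\<epsilon> \<in> borel_measurable M"
    and "Y \<in> borel_measurable M" and "X0 \<in> borel_measurable M"
    and "AE \<omega> in M. X \<omega> \<in> interior D"
    and "AE \<omega> in M. Y \<omega> = A (X \<omega>) + \<epsilon> \<omega>"
    \<comment> \<open>(i)\<close>
    and "\<tau> > 0"
    and "AE \<omega> in M. nn_cond_exp M (vimage_algebra (space M) X borel)
           (\<lambda>\<omega>. ennreal ((norm (\<epsilon> \<omega>))\<^sup>2)) \<omega> \<le> ennreal (\<tau>\<^sup>2)"
    \<comment> \<open>(ii)\<close>
    and "continuous_on D A" and "weakly_closed_operator D A"
    and "interior D \<noteq> {}" and "convex D"
    and "\<And>x. x \<in> interior D \<Longrightarrow> (A has_derivative blinfun_apply (A' x)) (at x)"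
    and "C0 > 0"
    and "\<And>x x'. x \<in> interior D \<Longrightarrow> x' \<in> interior D \<Longrightarrow> norm (A' x - A' x') \<le> C0 * norm (x - x')"
    \<comment> \<open>(iii)\<close>
    and "AE \<omega> in M. norm (X \<omega> - X0 \<omega>) \<le> 1"
    and "Z \<in> borel_measurable M" and "\<beta> > 0"
    and "AE \<omega> in M. X \<omega> - X0 \<omega> = adjoint (blinfun_apply (A' (X \<omega>))) (Z \<omega>)"
    and "AE \<omega> in M. norm (Z \<omega>) \<le> \<beta>"
    and "\<beta> * C0 < 1"
    \<comment> \<open>(iv)\<close>
    and "N \<ge> 1" and "0 < lam 1" and "mono_on {1..N} lam"
    and "Q = (lam N / lam 1) powr (1 / (real N - 1))"
    and "\<And>j. j \<in> {1..N} \<Longrightarrow> lam j = lam 1 * Q ^ (j - 1)"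
    and "\<tau> / \<beta> \<in> {lam 1..lam N}"
    \<comment> \<open>Tikhonov estimators\<close>
    and "\<And>\<alpha>. \<alpha> > 0 \<Longrightarrow> f \<alpha> \<in> borel_measurable borel"
    and "\<And>\<alpha>. \<alpha> > 0 \<Longrightarrow>
           AE \<omega> in M. is_arg_min (tikhonov A \<alpha> (Y \<omega>) (X0 \<omega>)) (\<lambda>x. x \<in> D) (f \<alpha> (Y \<omega>, X0 \<omega>))"
    \<comment> \<open>i.i.d. sample, each copy carrying its own initialization\<close>
    and "n \<ge> 1"
    and "prob_space.indep_vars M (\<lambda>_. borel) (\<lambda>i \<omega>. (Ys i \<omega>, Xs i \<omega>, X0s i \<omega>)) {1..n}"
    and "\<And>i. i \<in> {1..n} \<Longrightarrow>
           distr M borel (\<lambda>\<omega>. (Ys i \<omega>, Xs i \<omega>, X0s i \<omega>)) = distr M borel (\<lambda>\<omega>. (Y \<omega>, X \<omega>, X0 \<omega>))"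
    \<comment> \<open>data-driven parameter\<close>
    and "lam_hat \<in> borel_measurable M"
    and "\<And>\<omega>. \<omega> \<in> space M \<Longrightarrow>
           is_arg_min (\<lambda>\<alpha>. empirical_risk n Ys Xs X0s (f \<alpha>) \<omega>) (\<lambda>\<alpha>. \<alpha> \<in> lam ` {1..N}) (lam_hat \<omega>)"
    and "\<eta> \<in> {0<..<1}"
  shows "measure M {\<omega> \<in> space M.
           expected_risk M Y X X0 (f (lam_hat \<omega>))
             \<le> (1 + Q)\<^sup>2 / (2 * Q * (1 - \<beta> * C0)) * \<tau> * \<beta>
                 + 26 / real n * ln (2 * real N / \<eta>)}
         \<ge> 1 - \<eta>"
proof -
  interpret prob_space M by fact
  note X = assms(2) and err = assms(3) and Y = assms(4) and X0 = assms(5)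
  note f_meas = assms(29) and f_min = assms(30)
  have \<tau>0: "\<tau> > 0" and \<beta>0: "\<beta> > 0" and C00: "C0 > 0" and \<gamma>: "\<beta> * C0 < 1" by fact+
  define T where "T \<omega> = (Y \<omega>, X \<omega>, X0 \<omega>)" for \<omega>
  define Ts where "Ts i \<omega> = (Ys i \<omega>, Xs i \<omega>, X0s i \<omega>)" for i \<omega>
  \<comment> \<open>As a Borel function of the whole triple, the loss inherits independence and
    equality in law from the sample.\<close>
  define \<psi> where "\<psi> \<alpha> p = trunc_loss (snd (snd p)) (f \<alpha> (fst p, snd (snd p))) (fst (snd p))" for \<alpha> and p :: "'b \<times> 'a \<times> 'a"
  have T_meas: "T \<in> borel_measurable M"
    unfolding T_def[abs_def] using X Y X0 by (intro borel_measurable_Pair)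
  have Ts_ind: "indep_vars (\<lambda>_. borel) Ts {1..n}" using assms(32) by (simp add: Ts_def[abs_def])
  have Ts_meas: "Ts i \<in> borel_measurable M" if "i \<in> {1..n}" for i
    using Ts_ind that by (auto simp: indep_vars_def)
  have Ts_distr: "distr M borel (Ts i) = distr M borel T" if "i \<in> {1..n}" for i
    using assms(33)[OF that] by (simp add: Ts_def[abs_def] T_def[abs_def])
  have \<psi>_meas: "\<psi> \<alpha> \<in> borel_measurable borel" if "\<alpha> > 0" for \<alpha>
  proof -
    have [measurable]: "(\<lambda>p :: 'b \<times> 'a \<times> 'a. (fst p, snd (snd p))) \<in> borel_measurable borel"
      "(\<lambda>p :: 'b \<times> 'a \<times> 'a. snd (snd p)) \<in> borel_measurable borel"
      "(\<lambda>p :: 'b \<times> 'a \<times> 'a. fst (snd p)) \<in> borel_measurable borel"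
      by (intro borel_measurable_continuous_onI continuous_intros)+
    have [measurable]: "f \<alpha> \<in> borel_measurable borel" using f_meas that by blast
    show ?thesis unfolding \<psi>_def[abs_def] trunc_loss_def by measurable
  qed
  have \<psi>_bounds: "0 \<le> \<psi> \<alpha> p" "\<psi> \<alpha> p \<le> 4" for \<alpha> p
    using trunc_loss_bounds by (auto simp: \<psi>_def)
  define L where "L \<alpha> = expected_risk M Y X X0 (f \<alpha>)" for \<alpha>
  have L_eq: "L \<alpha> = expectation (\<lambda>\<omega>. \<psi> \<alpha> (T \<omega>))" for \<alpha>
    by (simp add: L_def expected_risk_def \<psi>_def T_def)
  have L_sample: "expectation (\<lambda>\<omega>. \<psi> \<alpha> (Ts i \<omega>)) = L \<alpha>" if "\<alpha> > 0" "i \<in> {1..n}" for \<alpha> i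
    using integral_distr[OF T_meas \<psi>_meas[OF that(1)]] integral_distr[OF Ts_meas \<psi>_meas[OF that(1)], of i]
      Ts_distr[OF that(2)] that by (simp add: L_eq)

  \<comment> \<open>Risk of a fixed parameter\<close>
  have err2: "(\<integral>\<^sup>+\<omega>. ennreal ((norm (\<epsilon> \<omega>))\<^sup>2) \<partial>M) \<le> ennreal (\<tau>\<^sup>2)"
    using X err assms(9) by (intro nn_integral_le_of_nn_cond_exp_le) auto
  have err_int: "integrable M (\<lambda>\<omega>. (norm (\<epsilon> \<omega>))\<^sup>2)"
    using err err2 by (intro integrableI_nonneg) (auto intro: le_less_trans)
  have err_exp: "expectation (\<lambda>\<omega>. (norm (\<epsilon> \<omega>))\<^sup>2) \<le> \<tau>\<^sup>2"
    using err2 err_int by (subst (asm) nn_integral_eq_integral) auto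

  have risk: "L \<alpha> \<le> (\<tau>\<^sup>2 + 2/3 * (\<alpha> * \<beta>)\<^sup>2) / (\<alpha> * (1 - \<beta> * C0))" if \<alpha>: "\<alpha> > 0" for \<alpha>
  proof -
    have pos: "\<alpha> * (1 - \<beta> * C0) > 0" using \<alpha> \<gamma> by simp
    have ae: "AE \<omega> in M. \<psi> \<alpha> (T \<omega>) \<le> ((norm (\<epsilon> \<omega>))\<^sup>2 + 2/3 * (\<alpha> * \<beta>)\<^sup>2) / (\<alpha> * (1 - \<beta> * C0))"
      using assms(6) assms(7) assms(17) assms(20) assms(21) f_min[OF \<alpha>]
    proof eventually_elim
      case (elim \<omega>)
      define \<xi> where "\<xi> = f \<alpha> (Y \<omega>, X0 \<omega>)"
      have min: "is_arg_min (tikhonov A \<alpha> (A (X \<omega>) + \<epsilon> \<omega>) (X0 \<omega>)) (\<lambda>x. x \<in> D) \<xi>"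
        using elim(2) elim(6) by (simp add: \<xi>_def)
      have "\<alpha> * (1 - \<beta> * C0) * (norm (\<xi> - X \<omega>))\<^sup>2 \<le> (norm (\<epsilon> \<omega>))\<^sup>2 + 2/3 * (\<alpha> * \<beta>)\<^sup>2"
        using assms(13) assms(10) assms(14) assms(16) C00 \<beta>0 \<alpha> elim(1) elim(4) elim(5) min
        by (rule tikhonov_error_bound)
      hence "(norm (\<xi> - X \<omega>))\<^sup>2 \<le> ((norm (\<epsilon> \<omega>))\<^sup>2 + 2/3 * (\<alpha> * \<beta>)\<^sup>2) / (\<alpha> * (1 - \<beta> * C0))"
        using pos by (simp add: pos_le_divide_eq mult.commute)
      moreover have "\<psi> \<alpha> (T \<omega>) \<le> (norm (\<xi> - X \<omega>))\<^sup>2"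
      proof -
        have "trunc (X \<omega> - X0 \<omega>) = X \<omega> - X0 \<omega>" using elim(3) by (simp add: trunc_def)
        thus ?thesis using norm_trunc_diff_le[OF elim(3), of "\<xi> - X0 \<omega>"]
          by (auto simp: \<psi>_def T_def trunc_loss_def \<xi>_def intro!: power_mono)
      qed
      ultimately show ?case by linarith
    qed
    have "L \<alpha> \<le> expectation (\<lambda>\<omega>. ((norm (\<epsilon> \<omega>))\<^sup>2 + 2/3 * (\<alpha> * \<beta>)\<^sup>2) / (\<alpha> * (1 - \<beta> * C0)))"
      unfolding L_eq
    proof (rule integral_mono_AE[OF _ _ ae])
      show "integrable M (\<lambda>\<omega>. \<psi> \<alpha> (T \<omega>))"
        using \<psi>_bounds T_meas \<psi>_meas[OF \<alpha>]
        by (intro integrable_const_bound[where B = 4] AE_I2) (auto intro: measurable_compose)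
    qed (use err_int in auto)
    also have "\<dots> = (expectation (\<lambda>\<omega>. (norm (\<epsilon> \<omega>))\<^sup>2) + 2/3 * (\<alpha> * \<beta>)\<^sup>2) / (\<alpha> * (1 - \<beta> * C0))"
      using err_int by (simp add: prob_space)
    also have "\<dots> \<le> (\<tau>\<^sup>2 + 2/3 * (\<alpha> * \<beta>)\<^sup>2) / (\<alpha> * (1 - \<beta> * C0))"
      using err_exp pos by (intro divide_right_mono) auto
    finally show ?thesis .
  qed

  have N1: "N \<ge> 1" and n1: "n \<ge> 1" and lam1: "lam 1 > 0" by fact+
  have \<eta>: "0 < \<eta>" "\<eta> < 1" using assms(36) by auto
  \<comment> \<open>For N = 1 the exponent is 1 / 0 = 0, so Q = 1.\<close>
  have Q1: "Q \<ge> 1"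
  proof -
    have "lam 1 \<le> lam N" using assms(25) N1 by (intro mono_onD[of "{1..N}" lam]) auto
    hence "lam N / lam 1 \<ge> 1" using lam1 by simp
    thus ?thesis unfolding assms(26) using N1 by (intro ge_one_powr_ge_zero) auto
  qed
  have lam_pos: "lam j > 0" if "j \<in> {1..N}" for j using assms(27)[OF that] lam1 Q1 by simp
  define K where "K = (1 + Q)\<^sup>2 / (2 * Q * (1 - \<beta> * C0)) * \<tau> * \<beta>"
  obtain j0 where j0: "j0 \<in> {1..N}"
    and q: "13/11 * (1 / (lam j0 / (\<tau> / \<beta>)) + 2 * (lam j0 / (\<tau> / \<beta>)) / 3) \<le> (1 + Q)\<^sup>2 / (2 * Q)"
    using geometric_grid_neighbour[of N lam Q "\<tau> / \<beta>"] N1 lam1 Q1 assms(27) assms(28) by blast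
  define R where "R = 11/13 * K"
  have K0: "K > 0" unfolding K_def using Q1 \<gamma> \<tau>0 \<beta>0 by simp
  have R0: "R > 0" using K0 by (simp add: R_def)
  have LR: "L (lam j0) \<le> R"
  proof -
    define u where "u = lam j0 / (\<tau> / \<beta>)"
    have u: "u > 0" and lu: "lam j0 = u * \<tau> / \<beta>" using lam_pos[OF j0] \<tau>0 \<beta>0 by (simp_all add: u_def)
    have "L (lam j0) \<le> (\<tau>\<^sup>2 + 2/3 * (lam j0 * \<beta>)\<^sup>2) / (lam j0 * (1 - \<beta> * C0))"
      using risk lam_pos[OF j0] by blast
    also have "\<dots> = (1/u + 2 * u / 3) * (\<tau> * \<beta> / (1 - \<beta> * C0))"
    proof -
      have "lam j0 * \<beta> = u * \<tau>" using \<beta>0 by (simp add: lu)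
      hence "\<tau>\<^sup>2 + 2/3 * (lam j0 * \<beta>)\<^sup>2 = \<tau>\<^sup>2 * (1 + 2/3 * u\<^sup>2)" by (simp add: power_mult_distrib algebra_simps)
      moreover have "\<tau>\<^sup>2 * (1 + 2/3 * u\<^sup>2) / (u * \<tau> / \<beta> * c) = (1/u + 2 * u / 3) * (\<tau> * \<beta> / c)" if "c > 0" for c
        using that u \<tau>0 \<beta>0 by (simp add: field_simps power2_eq_square)
      ultimately show ?thesis using \<gamma> unfolding lu by simp
    qed
    also have "\<dots> \<le> (11/13 * ((1 + Q)\<^sup>2 / (2 * Q))) * (\<tau> * \<beta> / (1 - \<beta> * C0))"
      using q[folded u_def] \<tau>0 \<beta>0 \<gamma> by (intro mult_right_mono) auto
    also have "\<dots> = R" by (simp add: R_def K_def)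
    finally show ?thesis .
  qed

  \<comment> \<open>Chosen so that exp (- n s) = \<eta> / N, the share of one grid point in the
    union bound.\<close>
  define s where "s = ln (real N / \<eta>) / real n"
  have s0: "s \<ge> 0" unfolding s_def using N1 \<eta> n1 by (intro divide_nonneg_nonneg) (auto simp: divide_simps)
  define B where "B = K + 26 / real n * ln (2 * real N / \<eta>)"
  have RB: "(sqrt R + 2 * sqrt s)\<^sup>2 \<le> B"
  proof -
    \<comment> \<open>The weight 11 leads to 13/11 R = K and to 4 + 22 = 26.\<close>
    have "0 \<le> (sqrt R - 11 * sqrt s)\<^sup>2" by simp
    hence "4 * (sqrt R * sqrt s) \<le> 2/11 * R + 22 * s" using R0 s0
      by (simp add: power2_diff power_mult_distrib)
    moreover have "(sqrt R + 2 * sqrt s)\<^sup>2 = R + 4 * (sqrt R * sqrt s) + 4 * s"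
      using R0 s0 by (simp add: power2_sum power_mult_distrib)
    ultimately have "(sqrt R + 2 * sqrt s)\<^sup>2 \<le> K + 26 * s" by (simp add: R_def)
    also have "26 * s \<le> 26 / real n * ln (2 * real N / \<eta>)"
      unfolding s_def using N1 \<eta> n1 by (simp add: divide_right_mono)
    finally show ?thesis by (simp add: B_def)
  qed

  \<comment> \<open>The copies inherit this bound from the law of the triple. Under it truncating Xs
    - X0s changes nothing, so the empirical risk is the sample mean of \<psi>.\<close>
  have bounded_sample: "AE \<omega> in M. \<forall>i\<in>{1..n}. norm (Xs i \<omega> - X0s i \<omega>) \<le> 1"
  proof (rule AE_ball_countable'[OF _ countable_finite])
    fix i assume i: "i \<in> {1..n}"
    have S: "{p \<in> space borel. norm (fst (snd p) - snd (snd p)) \<le> 1} \<in> sets (borel :: ('b \<times> 'a \<times> 'a) measure)"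
      by (auto intro!: borel_closed closed_Collect_le continuous_intros)
    have "AE \<omega> in M. norm (fst (snd (T \<omega>)) - snd (snd (T \<omega>))) \<le> 1"
      using assms(17) by (simp add: T_def)
    hence "AE p in distr M borel T. norm (fst (snd p) - snd (snd p)) \<le> 1"
      by (subst AE_distr_iff[OF T_meas S])
    hence "AE p in distr M borel (Ts i). norm (fst (snd p) - snd (snd p)) \<le> 1"
      by (simp only: Ts_distr[OF i])
    hence "AE \<omega> in M. norm (fst (snd (Ts i \<omega>)) - snd (snd (Ts i \<omega>))) \<le> 1"
      by (subst (asm) AE_distr_iff[OF Ts_meas[OF i] S])
    thus "AE \<omega> in M. norm (Xs i \<omega> - X0s i \<omega>) \<le> 1" by (simp add: Ts_def)
  qed simp
  have emp: "empirical_risk n Ys Xs X0s (f \<alpha>) \<omega> = 1 / real n * (\<Sum>i=1..n. \<psi> \<alpha> (Ts i \<omega>))"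
    if "\<forall>i\<in>{1..n}. norm (Xs i \<omega> - X0s i \<omega>) \<le> 1" for \<alpha> \<omega>
    unfolding empirical_risk_def using that
    by (intro arg_cong2[where f = "(*)"] refl sum.cong)
      (auto simp: \<psi>_def Ts_def trunc_loss_def trunc_def[of "Xs _ _ - X0s _ _"])

  \<comment> \<open>Union bound over the grid points of large risk\<close>
  define bad where "bad = {j \<in> {1..N}. B < L (lam j)}"
  \<comment> \<open>Division by 4 brings the losses into [0, 1]; it halves the square roots of the
    risks, which accounts for the factor 2 before \<open>sqrt s\<close> in
    \<open>RB\<close>.\<close>
  define E where "E j = {\<omega> \<in> space M. (\<Sum>i=1..n. \<psi> (lam j) (Ts i \<omega>) / 4) \<le> (\<Sum>i=1..n. \<psi> (lam j0) (Ts i \<omega>) / 4)}" for j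
  have E_meas: "E j \<in> sets M" if "j \<in> bad" for j
  proof -
    have [measurable]: "(\<lambda>\<omega>. \<psi> (lam k) (Ts i \<omega>)) \<in> borel_measurable M" if "k \<in> {1..N}" "i \<in> {1..n}" for k i
      using Ts_meas[OF that(2)] \<psi>_meas[OF lam_pos[OF that(1)]] by (rule measurable_compose)
    show ?thesis unfolding E_def using that j0 by (auto simp: bad_def intro!: borel_measurable_le borel_measurable_sum borel_measurable_divide)
  qed
  have E_prob: "prob (E j) \<le> \<eta> / real N" if j: "j \<in> bad" for j
  proof -
    have jN: "j \<in> {1..N}" and jB: "B < L (lam j)" using j by (auto simp: bad_def)
    have Lj: "sqrt R + 2 * sqrt s \<le> sqrt (L (lam j))"
      using RB jB by (intro real_le_rsqrt) linarith
    have "R \<le> L (lam j)"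
    proof -
      have "sqrt R \<le> sqrt (L (lam j))" using Lj real_sqrt_ge_zero[OF s0] by linarith
      thus ?thesis by simp
    qed
    have "prob (E j) \<le> exp (- real (card {1..n}) * (sqrt (L (lam j) / 4) - sqrt (R / 4))\<^sup>2)"
      unfolding E_def
    proof (rule prob_sum_le_sum)
      show "indep_vars (\<lambda>_. borel \<Otimes>\<^sub>M borel) (\<lambda>i \<omega>. (\<psi> (lam j) (Ts i \<omega>) / 4, \<psi> (lam j0) (Ts i \<omega>) / 4)) {1..n}"
        by (intro indep_vars_compose2[OF Ts_ind, of "\<lambda>_ p. (\<psi> (lam j) p / 4, \<psi> (lam j0) p / 4)"]
            measurable_Pair borel_measurable_divide borel_measurable_const
            \<psi>_meas[OF lam_pos[OF jN]] \<psi>_meas[OF lam_pos[OF j0]])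
      show "L (lam j) / 4 \<le> expectation (\<lambda>\<omega>. \<psi> (lam j) (Ts i \<omega>) / 4)" if "i \<in> {1..n}" for i
        using L_sample[OF lam_pos[OF jN] that] by simp
      show "expectation (\<lambda>\<omega>. \<psi> (lam j0) (Ts i \<omega>) / 4) \<le> R / 4" if "i \<in> {1..n}" for i
        using L_sample[OF lam_pos[OF j0] that] LR by simp
    qed (use \<psi>_bounds R0 \<open>R \<le> L (lam j)\<close> in auto)
    also have "\<dots> \<le> exp (- (real n * s))"
    proof -
      have "sqrt s \<le> sqrt (L (lam j) / 4) - sqrt (R / 4)"
        using Lj by (simp add: real_sqrt_divide)
      hence "(sqrt s)\<^sup>2 \<le> (sqrt (L (lam j) / 4) - sqrt (R / 4))\<^sup>2" using s0 by (intro power_mono) auto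
      thus ?thesis using s0 by (simp add: mult_left_mono)
    qed
    also have "\<dots> = \<eta> / real N"
      using n1 N1 \<eta> by (simp add: s_def exp_minus)
    finally show ?thesis .
  qed

  define G where "G = {\<omega> \<in> space M. L (lam_hat \<omega>) \<le> B}"
  have hat_mem: "\<exists>j\<in>{1..N}. lam_hat \<omega> = lam j" if "\<omega> \<in> space M" for \<omega>
    using assms(35)[OF that] by (auto simp: is_arg_min_def)
  have G_meas: "G \<in> sets M"
  proof -
    have "G = (\<Union>j\<in>{j\<in>{1..N}. L (lam j) \<le> B}. {\<omega> \<in> space M. lam_hat \<omega> = lam j})"
      using hat_mem by (fastforce simp: G_def)
    also have "\<dots> \<in> sets M" using assms(34) by (intro sets.finite_UN) auto
    finally show ?thesis .
  qed
  \<comment> \<open>If a bad grid point is selected, minimality of its empirical risk puts the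
    sample into the event that it does at least as well as \<open>j0\<close>.\<close>
  have "AE \<omega> in M. \<omega> \<in> space M - G \<longrightarrow> \<omega> \<in> (\<Union>j\<in>bad. E j)"
    using bounded_sample
  proof eventually_elim
    case (elim \<omega>)
    show ?case
    proof
      assume w: "\<omega> \<in> space M - G"
      then obtain j where j: "j \<in> {1..N}" "lam_hat \<omega> = lam j" using hat_mem by blast
      hence "j \<in> bad" using w by (auto simp: bad_def G_def)
      moreover have "empirical_risk n Ys Xs X0s (f (lam j)) \<omega> \<le> empirical_risk n Ys Xs X0s (f (lam j0)) \<omega>"
        using assms(35)[of \<omega>] w j j0 by (auto simp: is_arg_min_def not_less)
      hence "(\<Sum>i=1..n. \<psi> (lam j) (Ts i \<omega>)) \<le> (\<Sum>i=1..n. \<psi> (lam j0) (Ts i \<omega>))"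
        using n1 unfolding emp[OF elim] by (subst (asm) mult_le_cancel_left_pos) auto
      hence "\<omega> \<in> E j" using w unfolding E_def by (simp only: sum_divide_distrib[symmetric]) simp
      ultimately show "\<omega> \<in> (\<Union>j\<in>bad. E j)" by blast
    qed
  qed
  hence "prob (space M - G) \<le> prob (\<Union>j\<in>bad. E j)"
    using E_meas by (intro finite_measure_mono_AE) (auto simp: bad_def)
  also have "\<dots> \<le> (\<Sum>j\<in>bad. prob (E j))"
    using E_meas by (intro finite_measure_subadditive_finite) (auto simp: bad_def)
  also have "\<dots> \<le> (\<Sum>j\<in>bad. \<eta> / real N)" using E_prob by (rule sum_mono)
  also have "\<dots> \<le> (\<Sum>j\<in>{1..N}. \<eta> / real N)" using \<eta> by (intro sum_mono2) (auto simp: bad_def)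
  also have "\<dots> = \<eta>" using N1 by simp
  finally have "1 - \<eta> \<le> prob G" using prob_compl[OF G_meas] by linarith
  thus ?thesis unfolding G_def L_def B_def K_def .
qed

end
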